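(* Consider the planar Newtonian four-body problem with equal masses $m_1=m_2=m_3=m_4=1$. Let $q>2$ be an integer, let $L$ be the least common multiple of $2$ and $q$, and let $\widetilde G=D_L\times\mathbb{Z}_2$, where $D_L$ (dihedral of order $2L$) has generators $h_1,h_2$ and $\mathbb{Z}_2$ is generated by $h_3$, act with $\sigma(h_1)=(1\,2)(3\,4)$, $\sigma(h_2)=(1\,3)(2\,4)$, $\sigma(h_3)=(1\,2)(3\,4)$, with $\rho(h_1)$, $\rho(h_2)$ the reflections of the plane along lines $l_1,l_2$ through the origin meeting at the angle $\pi/q$, and $\rho(h_3)$ the rotation of angle $\pi$. Assume that all local minima of $\mathcal{A}^{\widetilde G}$ in $\Lambda^{\widetilde G}$ are collision-free. Then $\mathcal{A}^{\widetilde G}$ attains its minimum on $\Lambda^{\widetilde G}$, and a minimizer is a collision-free $T$-periodic solution which is not homographic.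
   Context: Let $T>0$, $T^1=\mathbb{R}/T\mathbb{Z}$, $\mathcal{X}=\{x\in(\mathbb{R}^2)^4:\sum_ix_i=0\}$, $\Lambda=H^1(T^1,\mathcal{X})$. The generators act on time by $h_1t=-t$, $h_2t=\frac TL-t$ and $h_3t=t$; $\rho\colon\widetilde G\to O(2)$ is the action on the plane and $\sigma\colon\widetilde G\to\Sigma_4$ the action on the indices. $\widetilde G$ acts on $\mathcal{X}$ by $(gx)_i=\rho(g)x_{\sigma(g)^{-1}(i)}$ and on $\Lambda$ by $(g\cdot x)(t)=g\,x(g^{-1}t)$; $\Lambda^{\widetilde G}$ is the set of loops fixed by $\widetilde G$. $\mathcal{A}(x)=\int_0^T\big(\sum_i\frac12|\dot x_i|^2+\sum_{i<j}\frac1{|x_i-x_j|}\big)dt$, $\mathcal{A}^{\widetilde G}=\mathcal{A}|_{\Lambda^{\widetilde G}}$. A loop is collision-free if $x_i(t)\neq x_j(t)$ for all $t$ and $i\ne j$. A solution is a solution of Newton's equations. It is homographic if, identifying the plane with $\mathbb{C}$, $x(t)=s(t)x(0)$ for a $\mathbb{C}$-valued function $s$. *)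

theory Defs
  imports
    "HOL-Analysis.Analysis"
    "HOL-Algebra.Group_Action"
    "HOL-Algebra.Elementary_Groups"
    "HOL-Library.Real_Mod"
begin

section \<open>The symmetry group\<close>

text \<open>The pair \<open>(k, e)\<close> stands for \<open>r\<^sup>k s\<^sup>e\<close>, where \<open>s\<close> is a reflection and \<open>r\<close> a
  rotation of order \<open>L\<close>, so that \<open>s r = r\<^sup>-\<^sup>1 s\<close>.\<close>

definition dihedral_group :: "nat \<Rightarrow> (int \<times> bool) monoid" where
  "dihedral_group L =
     \<lparr>carrier = {0..<int L} \<times> UNIV,
      monoid.mult = (\<lambda>(k, e) (k', e'). ((k + (if e then - k' else k')) mod int L, e \<noteq> e')),
      one = (0, False)\<rparr>"

lemma group_dihedral_group:
  assumes "L > 0"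
  shows "group (dihedral_group L)"
proof (rule groupI)
  fix x assume "x \<in> carrier (dihedral_group L)"
  then obtain k e where x: "x = (k, e)" "0 \<le> k" "k < int L"
    by (auto simp: dihedral_group_def)
  show "\<exists>y\<in>carrier (dihedral_group L). y \<otimes>\<^bsub>dihedral_group L\<^esub> x = \<one>\<^bsub>dihedral_group L\<^esub>"
    by (rule bexI[where x = "((if e then k else - k mod int L), e)"])
       (use assms x in \<open>auto simp: dihedral_group_def mod_simps\<close>)
qed (use assms in \<open>auto simp: dihedral_group_def mod_simps algebra_simps\<close>)

lemma order_dihedral_group: "order (dihedral_group L) = 2 * L"
  by (simp add: order_def dihedral_group_def card_cartesian_product)

definition sym_grp :: "nat \<Rightarrow> ((int \<times> bool) \<times> int) monoid" where
  "sym_grp L = dihedral_group L \<times>\<times> integer_mod_group 2"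

text \<open>In the notation above, \<open>h1 = s\<close> and \<open>h2 = r s\<close>, hence \<open>h2 h1 = r\<close>.\<close>

definition h1 :: "(int \<times> bool) \<times> int" where "h1 = ((0, True), 0)"
definition h2 :: "(int \<times> bool) \<times> int" where "h2 = ((1, True), 0)"
definition h3 :: "(int \<times> bool) \<times> int" where "h3 = ((0, False), 1)"


section \<open>Lines and reflections in the plane\<close>

text \<open>A line through the origin is given by a nonzero direction vector.\<close>

definition line_reflection :: "complex \<Rightarrow> complex \<Rightarrow> complex" where
  "line_reflection u z = (2 * (z \<bullet> u) / (u \<bullet> u)) *\<^sub>R u - z"

definition line_angle :: "complex \<Rightarrow> complex \<Rightarrow> real" where
  "line_angle u v = arccos (\<bar>u \<bullet> v\<bar> / (norm u * norm v))"


section \<open>Configurations and loops\<close>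

text \<open>The plane is \<open>complex\<close>. The index type \<open>4\<close> has exactly the four distinct elements
  \<open>1, 2, 3, 4\<close>, where \<open>4 = 0\<close>.\<close>

type_synonym config = "complex ^ 4"

definition config_space :: "config set" where
  "config_space = {x. (\<Sum>i\<in>UNIV. x $ i) = 0}"

text \<open>An \<open>H\<^sup>1\<close> loop is represented by its continuous representative, a \<open>T\<close>-periodic function on
  the real line: it is the integral of a square integrable function, its weak derivative.
  The latter is unique up to null sets.\<close>

definition has_weak_deriv :: "real \<Rightarrow> (real \<Rightarrow> config) \<Rightarrow> (real \<Rightarrow> config) \<Rightarrow> bool" where
  "has_weak_deriv T x v \<longleftrightarrow>
     v \<in> borel_measurable borel \<and>
     set_integrable lborel {0..T} (\<lambda>t. (norm (v t))\<^sup>2) \<and>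
     (\<forall>t\<in>{0..T}. x t = x 0 + (LINT s:{0..t}|lborel. v s))"

definition weak_deriv :: "real \<Rightarrow> (real \<Rightarrow> config) \<Rightarrow> real \<Rightarrow> config" where
  "weak_deriv T x = (SOME v. has_weak_deriv T x v)"

definition loop_space :: "real \<Rightarrow> (real \<Rightarrow> config) set" where
  "loop_space T =
     {x. (\<forall>t. x (t + T) = x t) \<and> (\<forall>t. x t \<in> config_space) \<and> (\<exists>v. has_weak_deriv T x v)}"

definition H1_norm :: "real \<Rightarrow> (real \<Rightarrow> config) \<Rightarrow> real" where
  "H1_norm T x =
     sqrt (LINT t:{0..T}|lborel. ((norm (x t))\<^sup>2 + (norm (weak_deriv T x t))\<^sup>2))"

text \<open>The action takes values in \<open>[0, \<infinity>]\<close>; division is that of \<open>ennreal\<close>, so the potential is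
  \<open>\<infinity>\<close> at a collision.\<close>

definition action :: "real \<Rightarrow> (real \<Rightarrow> config) \<Rightarrow> ennreal" where
  "action T x = (\<integral>\<^sup>+ t\<in>{0..T}.
     (ennreal (\<Sum>i\<in>UNIV. 1/2 * (norm (weak_deriv T x t $ i))\<^sup>2) +
      (\<Sum>(i, j)\<in>{(i, j). i < j}. 1 / ennreal (norm (x t $ i - x t $ j)))) \<partial>lborel)"


section \<open>The group action on loops\<close>

definition config_act ::
  "('g \<Rightarrow> complex \<Rightarrow> complex) \<Rightarrow> ('g \<Rightarrow> 4 \<Rightarrow> 4) \<Rightarrow> 'g \<Rightarrow> config \<Rightarrow> config" where
  "config_act \<rho> \<sigma> g x = (\<chi> i. \<rho> g (x $ inv_into UNIV (\<sigma> g) i))"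

text \<open>The circle \<open>\<real>/T\<int>\<close> is represented by \<open>{0..<T}\<close>, on which \<open>\<tau>\<close> acts; \<open>t rmod T\<close> is the
  representative of the class of \<open>t\<close>.\<close>

definition loop_act ::
  "('g, 'm) monoid_scheme \<Rightarrow> real \<Rightarrow> ('g \<Rightarrow> real \<Rightarrow> real) \<Rightarrow> ('g \<Rightarrow> complex \<Rightarrow> complex) \<Rightarrow>
   ('g \<Rightarrow> 4 \<Rightarrow> 4) \<Rightarrow> 'g \<Rightarrow> (real \<Rightarrow> config) \<Rightarrow> real \<Rightarrow> config" where
  "loop_act G T \<tau> \<rho> \<sigma> g x = (\<lambda>t. config_act \<rho> \<sigma> g (x (\<tau> (m_inv G g) (t rmod T))))"

definition fixed_loops ::
  "('g, 'm) monoid_scheme \<Rightarrow> real \<Rightarrow> ('g \<Rightarrow> real \<Rightarrow> real) \<Rightarrow> ('g \<Rightarrow> complex \<Rightarrow> complex) \<Rightarrow>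
   ('g \<Rightarrow> 4 \<Rightarrow> 4) \<Rightarrow> (real \<Rightarrow> config) set" where
  "fixed_loops G T \<tau> \<rho> \<sigma> =
     {x \<in> loop_space T. \<forall>g\<in>carrier G. loop_act G T \<tau> \<rho> \<sigma> g x = x}"


section \<open>Minima and properties of loops\<close>

definition is_local_min_action :: "real \<Rightarrow> (real \<Rightarrow> config) set \<Rightarrow> (real \<Rightarrow> config) \<Rightarrow> bool" where
  "is_local_min_action T S x \<longleftrightarrow> x \<in> S \<and>
     (\<exists>\<epsilon>>0. \<forall>y\<in>S. H1_norm T (\<lambda>t. y t - x t) < \<epsilon> \<longrightarrow> action T x \<le> action T y)"

definition is_min_action :: "real \<Rightarrow> (real \<Rightarrow> config) set \<Rightarrow> (real \<Rightarrow> config) \<Rightarrow> bool" where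
  "is_min_action T S x \<longleftrightarrow> x \<in> S \<and> (\<forall>y\<in>S. action T x \<le> action T y)"

definition collision_free :: "(real \<Rightarrow> config) \<Rightarrow> bool" where
  "collision_free x \<longleftrightarrow> (\<forall>t i j. i \<noteq> j \<longrightarrow> x t $ i \<noteq> x t $ j)"

definition newton_solution :: "(real \<Rightarrow> config) \<Rightarrow> bool" where
  "newton_solution x \<longleftrightarrow> (\<exists>v. \<forall>t. (x has_vector_derivative v t) (at t) \<and>
     (\<forall>i. ((\<lambda>s. v s $ i) has_vector_derivative
            (\<Sum>j\<in>UNIV - {i}. (1 / norm (x t $ i - x t $ j) ^ 3) *\<^sub>R (x t $ j - x t $ i))) (at t)))"

definition homographic :: "(real \<Rightarrow> config) \<Rightarrow> bool" where
  "homographic x \<longleftrightarrow> (\<exists>s :: real \<Rightarrow> complex. \<forall>t i. x t $ i = s t * x 0 $ i)"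

end

theory Submission
  imports Defs "HOL-Complex_Analysis.Great_Picard"
begin

text \<open>Being fixed by the group means being fixed by its three generators. The generator \<open>h3\<close> forces
  \<open>x\<^sub>2 = - x\<^sub>1\<close> and \<open>x\<^sub>4 = - x\<^sub>3\<close>, and \<open>(h2 h1)\<^sup>2\<close> gives \<open>x (t) = \<omega> x (t - 2T/L)\<close> for a rotation
  \<open>\<omega>\<close>, which is not the identity because \<open>q > 2\<close>. Hence the kinetic energy controls the
  \<open>H\<^sup>1\<close> norm, and the direct method yields a minimizer.

  Let \<open>x\<close> be a minimizer, collision-free by assumption. As \<open>\<omega> \<noteq> 1\<close>, the force \<open>\<nabla>U (x)\<close> has a periodic
  second primitive \<open>y\<close> with the symmetries of \<open>x\<close>. The first variation of the action in the
  direction \<open>x - y\<close> is the integral of \<open>|x' - y'|\<^sup>2\<close>, so \<open>x - y\<close> is constant and \<open>x'' = \<nabla>U (x)\<close>.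

  If \<open>x\<close> were homographic, then \<open>x\<^sub>1 (0)\<close> and \<open>x\<^sub>3 (0)\<close> would be real multiples of each other by
  \<open>h1\<close>, and of the same length by \<open>h2\<close> at \<open>t = T / (2L)\<close>, so bodies would collide.\<close>

section \<open>Square integrable functions\<close>

text \<open>Minimality is known only among symmetric loops, and the minimizer is a priori only of
  class H^1. Both obstacles are met by varying in one direction that is itself a symmetric loop, so
  that neither localized test functions nor a principle of symmetric criticality enter. That
  direction exists because differentiation is injective on functions with
  \<open>g t = \<omega> * g (t - 2 * T / L)\<close>: a constant of this kind vanishes when
  \<open>\<omega> \<noteq> 1\<close>. A primitive in this class therefore inherits the period and
  all symmetries of its integrand, up to a sign caused by time reversal, and no mean value has to be
  computed. The square of \<open>h2 h1\<close> is taken because \<open>h2 h1\<close> itself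
  exchanges bodies by (1 4)(2 3); only its square relates each body to itself. This makes \<omega>
  the fourth power of a unit number with real part \<open>cos (pi / q)\<close> up to sign, and such
  a number is neither real nor imaginary if \<open>q > 2\<close>. Collisions do not obstruct
  existence, since the potential is continuous with values in [0, \<infinity>] and Fatou's lemma
  applies to it.\<close>

lemma integrable_of_square_integrable:
  fixes f :: "'a \<Rightarrow> 'b::euclidean_space"
  assumes "finite_measure M" and [measurable]: "f \<in> borel_measurable M"
    and "integrable M (\<lambda>t. (norm (f t))\<^sup>2)"
  shows "integrable M f"
proof -
  interpret finite_measure M by fact
  have "integrable M (\<lambda>t. 1 + (norm (f t))\<^sup>2)"
    using assms(3) by auto
  then show ?thesis
  proof (rule Bochner_Integration.integrable_bound)
    have "norm (f t) \<le> 1 + (norm (f t))\<^sup>2" for t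
    proof -
      have "2 * norm (f t) \<le> 1 + (norm (f t))\<^sup>2"
        using sum_squares_bound[of 1 "norm (f t)"] by simp
      then show ?thesis using norm_ge_zero[of "f t"] by linarith
    qed
    then show "AE t in M. norm (f t) \<le> norm (1 + (norm (f t))\<^sup>2)"
      by (intro AE_I2) simp
  qed simp
qed

lemma integrable_square_norm_add:
  fixes f g :: "'a \<Rightarrow> 'b::euclidean_space"
  assumes [measurable]: "f \<in> borel_measurable M" "g \<in> borel_measurable M"
    and "integrable M (\<lambda>t. (norm (f t))\<^sup>2)" "integrable M (\<lambda>t. (norm (g t))\<^sup>2)"
  shows "integrable M (\<lambda>t. (norm (f t + g t))\<^sup>2)"
proof (rule Bochner_Integration.integrable_bound)
  show "integrable M (\<lambda>t. 2 * (norm (f t))\<^sup>2 + 2 * (norm (g t))\<^sup>2)"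
    using assms by auto
  have "(norm (f t + g t))\<^sup>2 \<le> 2 * (norm (f t))\<^sup>2 + 2 * (norm (g t))\<^sup>2" for t
    using zero_le_power2[of "norm (f t - g t)"]
    by (simp add: power2_norm_eq_inner inner_simps inner_commute)
  then show "AE t in M. norm ((norm (f t + g t))\<^sup>2) \<le> norm (2 * (norm (f t))\<^sup>2 + 2 * (norm (g t))\<^sup>2)"
    by (intro AE_I2) auto
qed simp

lemma integrable_square_norm_scaleR:
  fixes f :: "'a \<Rightarrow> 'b::euclidean_space"
  assumes "integrable M (\<lambda>t. (norm (f t))\<^sup>2)"
  shows "integrable M (\<lambda>t. (norm (c *\<^sub>R f t))\<^sup>2)"
  using assms by (simp add: power_mult_distrib)

lemma integrable_square_norm_diff:
  fixes f g :: "'a \<Rightarrow> 'b::euclidean_space"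
  assumes [measurable]: "f \<in> borel_measurable M" "g \<in> borel_measurable M"
    and "integrable M (\<lambda>t. (norm (f t))\<^sup>2)" "integrable M (\<lambda>t. (norm (g t))\<^sup>2)"
  shows "integrable M (\<lambda>t. (norm (f t - g t))\<^sup>2)"
  using integrable_square_norm_add[of f M "\<lambda>t. - g t"] assms by simp

lemma integrable_inner_of_square_integrable:
  fixes f g :: "'a \<Rightarrow> 'b::euclidean_space"
  assumes [measurable]: "f \<in> borel_measurable M" "g \<in> borel_measurable M"
    and "integrable M (\<lambda>t. (norm (f t))\<^sup>2)" "integrable M (\<lambda>t. (norm (g t))\<^sup>2)"
  shows "integrable M (\<lambda>t. f t \<bullet> g t)"
proof -
  have "f t \<bullet> g t = ((norm (f t + g t))\<^sup>2 - (norm (f t))\<^sup>2 - (norm (g t))\<^sup>2) / 2" for t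
    by (simp add: dot_norm)
  then show ?thesis
    using integrable_square_norm_add[OF assms] assms
    by (simp only: integrable_divide_zero Bochner_Integration.integrable_diff simp_thms)
qed

text \<open>Cauchy-Schwarz for a vector-valued integrand. With \<open>m\<close> the integral of
  \<open>f\<close> and \<mu> the total mass, the integral of the square of
  \<open>norm (\<mu> *\<^sub>R f t - m)\<close> is nonnegative, and expanding it gives \<mu> times
  the difference of the two sides.\<close>

lemma square_norm_integral_le:
  fixes f :: "'a \<Rightarrow> 'b::euclidean_space"
  assumes "finite_measure M" and f[measurable]: "f \<in> borel_measurable M"
    and f2: "integrable M (\<lambda>t. (norm (f t))\<^sup>2)"
  shows "(norm (LINT t|M. f t))\<^sup>2 \<le> measure M (space M) * (LINT t|M. (norm (f t))\<^sup>2)"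
proof -
  interpret finite_measure M by fact
  define m where "m = (LINT t|M. f t)"
  define \<mu> where "\<mu> = measure M (space M)"
  have f1: "integrable M f" by (rule integrable_of_square_integrable) fact+
  show ?thesis
  proof (cases "\<mu> = 0")
    case True
    then have "AE t in M. f t = 0"
      by (intro emeasure_0_AE) (simp add: \<mu>_def emeasure_eq_measure)
    then have "m = 0" unfolding m_def by (rule integral_eq_zero_AE)
    then show ?thesis by (simp add: m_def)
  next
    case False
    then have pos: "\<mu> > 0" unfolding \<mu>_def by (simp add: zero_less_measure_iff measure_nonneg order_less_le)
    have "0 \<le> (LINT t|M. (norm (\<mu> *\<^sub>R f t - m))\<^sup>2)"
      by (rule integral_nonneg_AE) auto
    also have "\<dots> = (LINT t|M. \<mu>\<^sup>2 * (norm (f t))\<^sup>2 - (2 * \<mu>) * (m \<bullet> f t) + (norm m)\<^sup>2)"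
    proof -
      have "(norm (\<mu> *\<^sub>R y - m))\<^sup>2 = \<mu>\<^sup>2 * (norm y)\<^sup>2 - (2 * \<mu>) * (m \<bullet> y) + (norm m)\<^sup>2" for y
        unfolding power2_norm_eq_inner
        by (simp add: inner_diff_left inner_diff_right inner_commute power2_eq_square algebra_simps)
      then show ?thesis by simp
    qed
    also have "\<dots> = \<mu>\<^sup>2 * (LINT t|M. (norm (f t))\<^sup>2) - (2 * \<mu>) * (m \<bullet> m) + (norm m)\<^sup>2 * \<mu>"
      using f1 f2 by (simp add: m_def \<mu>_def mult.commute)
    also have "\<dots> = \<mu> * (\<mu> * (LINT t|M. (norm (f t))\<^sup>2) - (norm m)\<^sup>2)"
      by (simp add: dot_square_norm power2_eq_square algebra_simps)
    finally show ?thesis using pos unfolding m_def \<mu>_def[symmetric]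
      by (simp add: zero_le_mult_iff)
  qed
qed

text \<open>Fatou's lemma for Bochner integrals; the finite bound also yields integrability of the
  limit. The bounds \<open>c i\<close> may vary with \<open>i\<close>, since almost minimal elements
  satisfy the limiting bound only up to an error that tends to 0.\<close>

lemma integral_le_of_AE_limit:
  fixes f :: "nat \<Rightarrow> 'a \<Rightarrow> real"
  assumes f[measurable]: "\<And>i. integrable M (f i)" and g[measurable]: "g \<in> borel_measurable M"
    and nonneg: "\<And>i s. 0 \<le> f i s" and lim: "AE s in M. (\<lambda>i. f i s) \<longlonglongrightarrow> g s"
    and le: "\<And>i. (LINT s|M. f i s) \<le> c i" and c: "c \<longlonglongrightarrow> c0"
  shows "integrable M g" "(LINT s|M. g s) \<le> c0"
proof -
  have [measurable]: "f i \<in> borel_measurable M" for i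
    using f by blast
  have g_nonneg: "AE s in M. 0 \<le> g s"
    using lim by eventually_elim (use nonneg in \<open>auto intro: LIMSEQ_le_const\<close>)
  have int: "0 \<le> (LINT s|M. f i s)" for i
    by (rule integral_nonneg_AE) (simp add: nonneg)
  have "0 \<le> c i" for i using int[of i] le[of i] by simp
  then have "0 \<le> c0"
    using c by (auto intro: LIMSEQ_le_const)
  have "(\<integral>\<^sup>+s. ennreal (g s) \<partial>M) = (\<integral>\<^sup>+s. liminf (\<lambda>i. ennreal (f i s)) \<partial>M)"
  proof (rule nn_integral_cong_AE)
    show "AE s in M. ennreal (g s) = liminf (\<lambda>i. ennreal (f i s))"
      using lim by eventually_elim (metis lim_imp_Liminf sequentially_bot tendsto_ennrealI)
  qed
  also have "\<dots> \<le> liminf (\<lambda>i. \<integral>\<^sup>+s. ennreal (f i s) \<partial>M)"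
    by (rule nn_integral_liminf) simp
  also have "\<dots> \<le> liminf (\<lambda>i. ennreal (c i))"
  proof (intro Liminf_mono always_eventually allI)
    show "(\<integral>\<^sup>+s. ennreal (f i s) \<partial>M) \<le> ennreal (c i)" for i
      using f[of i] le[of i] by (simp add: nn_integral_eq_integral nonneg ennreal_leI)
  qed
  also have "\<dots> = ennreal c0"
    using c by (metis lim_imp_Liminf sequentially_bot tendsto_ennrealI)
  finally have le': "(\<integral>\<^sup>+s. ennreal (g s) \<partial>M) \<le> ennreal c0" .
  show gi: "integrable M g"
    by (rule integrableI_nonneg) (use g_nonneg le' in \<open>auto simp: less_top[symmetric] top_unique\<close>)
  have "ennreal (LINT s|M. g s) \<le> ennreal c0"
    using le' nn_integral_eq_integral[OF gi g_nonneg] by simp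
  then show "(LINT s|M. g s) \<le> c0"
    using \<open>0 \<le> c0\<close> by simp
qed

text \<open>The role of weak compactness in \<open>L\<^sup>2\<close> is played by the parallelogram law: almost
  minimal elements of the decreasing convex sets \<open>K n\<close> form a Cauchy sequence.\<close>

theorem square_integrable_limit:
  fixes v :: "nat \<Rightarrow> 'a \<Rightarrow> 'b::euclidean_space"
  assumes M: "finite_measure M"
    and v: "\<And>n. v n \<in> borel_measurable M" "\<And>n. integrable M (\<lambda>s. (norm (v n s))\<^sup>2)"
      "\<And>n. (LINT s|M. (norm (v n s))\<^sup>2) \<le> C"
    and A: "\<And>t. t \<in> S \<Longrightarrow> A t \<in> sets M"
    and lim: "\<And>e. e > 0 \<Longrightarrow> \<exists>N. \<forall>n\<ge>N. \<forall>t\<in>S. norm ((LINT s:A t|M. v n s) - x t) \<le> e"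
  obtains w where "w \<in> borel_measurable M" "integrable M (\<lambda>s. (norm (w s))\<^sup>2)"
    "(LINT s|M. (norm (w s))\<^sup>2) \<le> C" "\<And>t. t \<in> S \<Longrightarrow> (LINT s:A t|M. w s) = x t"
proof -
  interpret finite_measure M by fact
  define Q where "Q f = (LINT s|M. (norm (f s))\<^sup>2)" for f :: "'a \<Rightarrow> 'b"
  define L2 where "L2 = {f :: 'a \<Rightarrow> 'b. f \<in> borel_measurable M \<and> integrable M (\<lambda>s. (norm (f s))\<^sup>2)}"
  define I where "I f t = (LINT s:A t|M. f s)" for f :: "'a \<Rightarrow> 'b" and t
  define e where "e n = 1 / real (Suc n)" for n
  \<comment> \<open>Relaxed constraint: the prescribed integrals need only be met up to
    \<open>e n\<close>. Every \<open>K n\<close> is convex and contains some \<open>v k\<close> by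
    \<open>lim\<close>, so the infimum \<open>d n\<close> of the energy on it is at most
    \<open>C\<close>.\<close>
  define K where "K n = {f \<in> L2. \<forall>t\<in>S. norm (I f t - x t) \<le> e n}" for n
  define d where "d n = Inf (Q ` K n)" for n
  have e_pos: "e n > 0" for n by (simp add: e_def)
  have e_mono: "e m \<le> e n" if "n \<le> m" for m n
    using that by (simp add: e_def frac_le)
  have e_lim: "e \<longlonglongrightarrow> 0"
    using LIMSEQ_inverse_real_of_nat by (simp add: e_def[abs_def] inverse_eq_divide)
  have L2_int: "integrable M f" if "f \<in> L2" for f
    using that integrable_of_square_integrable[OF M] by (auto simp: L2_def)
  have L2_set_int: "set_integrable M (A t) f" if "f \<in> L2" "t \<in> S" for f t
    unfolding set_integrable_def
    by (rule integrable_mult_indicator) (use that A L2_int in auto)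
  have L2_diff: "(\<lambda>s. f s - g s) \<in> L2" if "f \<in> L2" "g \<in> L2" for f g
    using that by (auto simp: L2_def integrable_square_norm_diff)
  have Q_nonneg: "0 \<le> Q f" for f
    unfolding Q_def by (rule integral_nonneg_AE) simp
  have bdd: "bdd_below (Q ` K n)" for n
    by (rule bdd_belowI[of _ 0]) (use Q_nonneg in auto)
  have d_le: "d n \<le> Q f" if "f \<in> K n" for f n
    unfolding d_def using bdd that by (auto intro: cInf_lower)
  have vK: "\<exists>k. v k \<in> K n" for n
    using lim[OF e_pos[of n]] v by (auto simp: K_def L2_def I_def) (metis order_refl)
  have d_C: "d n \<le> C" for n
    using vK[of n] d_le v(3) unfolding Q_def by (meson order_trans)
  have K_mono: "K m \<subseteq> K n" if "n \<le> m" for m n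
    using e_mono[OF that] by (force simp: K_def)
  have "incseq d"
    unfolding d_def incseq_def
  proof (intro allI impI cInf_superset_mono image_mono K_mono bdd)
    show "Q ` K n \<noteq> {}" for n using vK[of n] by auto
  qed
  then obtain D where D: "d \<longlonglongrightarrow> D" "\<And>n. d n \<le> D"
    using incseq_convergent[of d C] d_C by blast
  have "D \<le> C"
    using D(1) d_C by (auto intro: LIMSEQ_le_const2)
  have "\<exists>f\<in>K n. Q f < d n + e n" for n
    using cInf_lessD[of "Q ` K n" "d n + e n"] vK[of n] e_pos[of n] by (auto simp: d_def)
  then obtain w where w: "\<And>n. w n \<in> K n" "\<And>n. Q (w n) < d n + e n"
    by metis
  have wL2: "w n \<in> L2" for n using w(1) by (auto simp: K_def)
  then have [measurable]: "w n \<in> borel_measurable M" for n by (auto simp: L2_def)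
  \<comment> \<open>The midpoint of \<open>w n\<close> and \<open>w m\<close> with
    \<open>n \<le> m\<close> lies in \<open>K n\<close>, so its energy is at least
    \<open>d n\<close>. The parallelogram law then bounds the energy of \<open>w n - w m\<close> by
    \<open>2 * (D - d n) + 4 * e n\<close>, and Cauchy-Schwarz turns this into the bound
    \<open>a n\<close> in L^1.\<close>
  define a where "a n = sqrt (measure M (space M) * (2 * (D - d n) + 4 * e n))" for n
  have a_lim: "a \<longlonglongrightarrow> 0"
  proof -
    have "a \<longlonglongrightarrow> sqrt (measure M (space M) * (2 * (D - D) + 4 * 0))"
      unfolding a_def by (intro tendsto_intros D e_lim)
    then show ?thesis by simp
  qed
  have L1: "(LINT s|M. norm (w n s - w m s)) \<le> a n" if nm: "n \<le> m" for n m
  proof -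
    let ?h = "\<lambda>s. (1/2) *\<^sub>R (w n s + w m s)"
    have wm: "w m \<in> K n" using K_mono[OF nm] w(1) by auto
    have hL2: "?h \<in> L2"
      using wL2[of n] wL2[of m] unfolding L2_def
      by (auto simp: power_divide integrable_square_norm_add)
    have "?h \<in> K n"
    proof -
      have "norm (I ?h t - x t) \<le> e n" if t: "t \<in> S" for t
      proof -
        have "I ?h t = (1/2) *\<^sub>R (I (w n) t + I (w m) t)"
          unfolding I_def using L2_set_int[OF wL2 t] by simp
        then have "I ?h t - x t = (1/2) *\<^sub>R ((I (w n) t - x t) + (I (w m) t - x t))"
          by (simp add: algebra_simps flip: scaleR_add_left)
        moreover have "norm (I (w n) t - x t) \<le> e n" "norm (I (w m) t - x t) \<le> e n"
          using w(1)[of n] wm t by (auto simp: K_def)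
        ultimately show ?thesis
          using norm_triangle_ineq[of "I (w n) t - x t" "I (w m) t - x t"] by simp
      qed
      then show ?thesis using hL2 by (simp add: K_def)
    qed
    then have h: "d n \<le> Q ?h" by (rule d_le)
    have par: "(norm (y - z))\<^sup>2 = 2 * (norm y)\<^sup>2 + 2 * (norm z)\<^sup>2 - 4 * (norm ((1/2) *\<^sub>R (y + z)))\<^sup>2"
      for y z :: 'b
      unfolding power2_norm_eq_inner
      by (simp add: inner_diff_left inner_diff_right inner_add_left inner_add_right inner_commute algebra_simps)
    have "Q (\<lambda>s. w n s - w m s) = 2 * Q (w n) + 2 * Q (w m) - 4 * Q ?h"
      using wL2[of n] wL2[of m] hL2 unfolding Q_def L2_def par by simp
    also have "\<dots> \<le> 2 * (d n + e n) + 2 * (D + e n) - 4 * d n"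
    proof -
      have "2 * q + 2 * q' - 4 * q'' \<le> 2 * (d n + e n) + 2 * (D + e n) - 4 * d n"
        if "q < d n + e n" "q' < d m + e m" "d n \<le> q''" for q q' q''
        using that D(2)[of m] e_mono[OF nm] by argo
      then show ?thesis using w(2)[of n] w(2)[of m] h by blast
    qed
    finally have Qd: "Q (\<lambda>s. w n s - w m s) \<le> 2 * (D - d n) + 4 * e n" by simp
    have dL2: "(\<lambda>s. w n s - w m s) \<in> L2" by (rule L2_diff[OF wL2 wL2])
    have "(LINT s|M. norm (w n s - w m s))\<^sup>2 \<le> measure M (space M) * Q (\<lambda>s. w n s - w m s)"
      using square_norm_integral_le[OF M, of "\<lambda>s. norm (w n s - w m s)"] dL2
      by (simp add: Q_def L2_def)
    also have "\<dots> \<le> measure M (space M) * (2 * (D - d n) + 4 * e n)"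
      by (rule mult_left_mono[OF Qd]) simp
    finally show ?thesis
      unfolding a_def by (rule real_le_rsqrt)
  qed
  have Cauchy_L1: "\<exists>N. \<forall>i\<ge>N. \<forall>j\<ge>N. (LINT s|M. norm (w i s - w j s)) < \<epsilon>" if eps: "\<epsilon> > 0" for \<epsilon>
  proof -
    obtain N where N: "\<And>n. n \<ge> N \<Longrightarrow> a n < \<epsilon>"
      using order_tendstoD(2)[OF a_lim eps] by (auto simp: eventually_sequentially)
    have "(LINT s|M. norm (w i s - w j s)) < \<epsilon>" if "i \<ge> N" "j \<ge> N" for i j
    proof (cases "i \<le> j")
      case True then show ?thesis using L1[OF True] N[OF that(1)] by simp
    next
      case False
      then show ?thesis using L1[of j i] N[OF that(2)] by (simp add: norm_minus_commute)
    qed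
    then show ?thesis by blast
  qed
  \<comment> \<open>Being Cauchy in L^1 suffices for a subsequence that converges almost everywhere;
    the square integrability of its limit is recovered by Fatou's lemma.\<close>
  obtain r where r: "strict_mono r" "AE s in M. Cauchy (\<lambda>i. w (r i) s)"
    using cauchy_L1_AE_cauchy_subseq[of M w, OF L2_int[OF wL2] Cauchy_L1] by blast
  define W where "W s = lim (\<lambda>i. w (r i) s)" for s
  have W_meas[measurable]: "W \<in> borel_measurable M"
    unfolding W_def by measurable
  have W_lim: "AE s in M. (\<lambda>i. w (r i) s) \<longlonglongrightarrow> W s"
    using r(2) by eventually_elim (auto simp: W_def Cauchy_convergent convergent_LIMSEQ_iff[symmetric])
  have er: "(\<lambda>i. e (r i)) \<longlonglongrightarrow> 0" and ar: "(\<lambda>i. a (r i)) \<longlonglongrightarrow> 0"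
    using LIMSEQ_subseq_LIMSEQ[OF e_lim r(1)] LIMSEQ_subseq_LIMSEQ[OF a_lim r(1)] by (auto simp: o_def)
  have c_lim: "(\<lambda>i. C + e (r i)) \<longlonglongrightarrow> C"
    using tendsto_add[OF tendsto_const er, of C] by simp
  have Q_le: "(LINT s|M. (norm (w (r i) s))\<^sup>2) \<le> C + e (r i)" for i
    using w(2)[of "r i"] d_C[of "r i"] by (simp add: Q_def)
  have W2: "integrable M (\<lambda>s. (norm (W s))\<^sup>2)" "(LINT s|M. (norm (W s))\<^sup>2) \<le> C"
  proof -
    have lims: "AE s in M. (\<lambda>i. (norm (w (r i) s))\<^sup>2) \<longlonglongrightarrow> (norm (W s))\<^sup>2"
      using W_lim by eventually_elim (intro tendsto_intros)
    have ints: "integrable M (\<lambda>s. (norm (w (r i) s))\<^sup>2)" for i using wL2 by (auto simp: L2_def)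
    show "integrable M (\<lambda>s. (norm (W s))\<^sup>2)" "(LINT s|M. (norm (W s))\<^sup>2) \<le> C"
      using integral_le_of_AE_limit[OF ints _ _ lims Q_le c_lim] by auto
  qed
  have WL2: "W \<in> L2" using W2 by (simp add: L2_def)
  \<comment> \<open>Fatou's lemma in the second index of \<open>L1\<close>. The shift to
    \<open>r (i + k)\<close> keeps this index above \<open>r k\<close>, as \<open>L1\<close>
    demands.\<close>
  have W_L1: "(LINT s|M. norm (w (r k) s - W s)) \<le> a (r k)" for k
  proof -
    have "AE s in M. (\<lambda>i. norm (w (r k) s - w (r (i + k)) s)) \<longlonglongrightarrow> norm (w (r k) s - W s)"
      using W_lim by eventually_elim (intro tendsto_intros LIMSEQ_ignore_initial_segment)
    moreover have "integrable M (\<lambda>s. norm (w (r k) s - w (r (i + k)) s))" for i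
      using L2_int[OF L2_diff[OF wL2 wL2]] by simp
    moreover have "(LINT s|M. norm (w (r k) s - w (r (i + k)) s)) \<le> a (r k)" for i
      by (rule L1) (use r(1) in \<open>simp add: strict_mono_less_eq\<close>)
    ultimately show ?thesis
      using integral_le_of_AE_limit(2)[where c = "\<lambda>_. a (r k)" and f = "\<lambda>i s. norm (w (r k) s - w (r (i + k)) s)"]
      by auto
  qed
  have "I W t = x t" if t: "t \<in> S" for t
  proof (rule LIMSEQ_unique)
    have "norm (I (w (r k)) t - I W t) \<le> a (r k)" for k
    proof -
      have "I (w (r k)) t - I W t = (LINT s:A t|M. w (r k) s - W s)"
        unfolding I_def using L2_set_int[OF wL2 t] L2_set_int[OF WL2 t] by simp
      also have "norm \<dots> \<le> (LINT s:A t|M. norm (w (r k) s - W s))"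
        by (rule set_integral_norm_bound[OF L2_set_int[OF L2_diff[OF wL2 WL2] t]])
      also have "\<dots> \<le> (LINT s|M. norm (w (r k) s - W s))"
        unfolding set_lebesgue_integral_def
        using L2_int[OF L2_diff[OF wL2 WL2, of "r k"]] A[OF t]
        by (intro integral_mono integrable_mult_indicator) (auto simp: indicator_def)
      finally show ?thesis using W_L1[of k] by simp
    qed
    then have "(\<lambda>k. I (w (r k)) t - I W t) \<longlonglongrightarrow> 0"
      using ar by (rule Lim_null_comparison[OF always_eventually, rule_format])
    then show "(\<lambda>k. I (w (r k)) t) \<longlonglongrightarrow> I W t" by (simp add: LIM_zero_iff)
    have "norm (I (w (r k)) t - x t) \<le> e (r k)" for k
      using w(1)[of "r k"] t by (auto simp: K_def)
    then have "(\<lambda>k. I (w (r k)) t - x t) \<longlonglongrightarrow> 0"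
      using er by (rule Lim_null_comparison[OF always_eventually, rule_format])
    then show "(\<lambda>k. I (w (r k)) t) \<longlonglongrightarrow> x t" by (simp add: LIM_zero_iff)
  qed
  then show thesis
    using that[of W] W2 by (simp add: I_def)
qed

section \<open>Weak derivatives\<close>

text \<open>The half lines are stable under intersection and generate the Borel sets, and the sets
  over which the integral of \<open>g\<close> vanishes are closed under complements and countable
  disjoint unions. So the integral vanishes over every Borel set, which forces \<open>g = 0\<close>
  almost everywhere.\<close>

lemma AE_zero_of_integral_atMost_zero:
  fixes g :: "real \<Rightarrow> 'b::euclidean_space"
  assumes g: "integrable lborel g" and zero: "\<And>a. (LINT s:{..a}|lborel. g s) = 0"
  shows "AE s in lborel. g s = 0"
proof (rule sigma_finite_measure.density_zero[OF sigma_finite_lborel g])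
  have set_int: "set_integrable lborel A g" if "A \<in> sets borel" for A
    unfolding set_integrable_def by (rule integrable_mult_indicator) (use that g in auto)
  \<comment> \<open>The integral over the whole line, as a limit over half lines, is what closure
    under complements needs.\<close>
  have UNIV0: "(LINT s|lborel. g s) = 0"
  proof (rule LIMSEQ_unique)
    have mono: "incseq (\<lambda>n. {..real n})" by (auto simp: incseq_def)
    have un: "(\<Union>n. {..real n}) = UNIV" by (auto simp: real_arch_simple)
    have "(\<lambda>n. LINT s:{..real n}|lborel. g s) \<longlonglongrightarrow> (LINT s:(\<Union>n. {..real n})|lborel. g s)"
      by (rule set_integral_cont_up[OF _ mono]) (auto intro: set_int simp: un)
    then show "(\<lambda>n. LINT s:{..real n}|lborel. g s) \<longlonglongrightarrow> (LINT s|lborel. g s)"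
      by (simp add: un set_lebesgue_integral_def)
  qed (simp add: zero)
  fix A :: "real set" assume "A \<in> sets lborel"
  then have A: "A \<in> sigma_sets UNIV (range atMost)"
    by (simp add: borel_eq_atMost)
  have "Int_stable (range (atMost :: real \<Rightarrow> real set))"
    by (auto simp: Int_stable_def)
  moreover have "range (atMost :: real \<Rightarrow> real set) \<subseteq> Pow UNIV" by simp
  ultimately show "(LINT s:A|lborel. g s) = 0"
    using A
  proof (induction rule: sigma_sets_induct_disjoint)
    case (basic A) then show ?case using zero by auto
  next
    case empty then show ?case by (simp add: set_lebesgue_integral_def)
  next
    case (compl A)
    then have A: "A \<in> sets borel" by (simp add: borel_eq_atMost)
    have "(LINT s:A \<union> (UNIV - A)|lborel. g s) = (LINT s:A|lborel. g s) + (LINT s:UNIV - A|lborel. g s)"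
      using A by (intro set_integral_Un set_int) auto
    then show ?case using compl UNIV0 by (simp add: set_lebesgue_integral_def)
  next
    case (union A)
    then have A: "A i \<in> sets borel" for i by (auto simp: borel_eq_atMost)
    have "(LINT s:(\<Union>i. A i)|lborel. g s) = (\<Sum>i. (LINT s:A i|lborel. g s))"
    proof (rule lebesgue_integral_countable_add)
      show "A i \<inter> A j = {}" if "i \<noteq> j" for i j
        using union that by (auto simp: disjoint_family_on_def)
      show "set_integrable lborel (\<Union>i. A i) g" using A by (intro set_int) auto
    qed (use A in auto)
    then show ?case using union by simp
  qed
qed

lemma finite_measure_restrict_Icc: "finite_measure (restrict_space lborel {a..b::real})"
  by (rule finite_measureI) (simp add: emeasure_restrict_space space_restrict_space emeasure_lborel_Icc_eq)

lemma measure_restrict_Icc: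
  "a \<le> b \<Longrightarrow> measure (restrict_space lborel {a..b::real}) (space (restrict_space lborel {a..b})) = b - a"
  by (simp add: measure_restrict_space space_restrict_space)

lemma set_integral_eq_restrict_space:
  fixes f :: "real \<Rightarrow> 'b::euclidean_space"
  shows "(LINT s:{a..b}|lborel. f s) = (LINT s|restrict_space lborel {a..b}. f s)"
  by (simp add: integral_restrict_space set_lebesgue_integral_def)

lemma square_norm_set_integral_le:
  fixes f :: "real \<Rightarrow> 'b::euclidean_space"
  assumes f[measurable]: "f \<in> borel_measurable borel" and "a \<le> b"
    and f2: "set_integrable lborel {a..b} (\<lambda>t. (norm (f t))\<^sup>2)"
  shows "(norm (LINT t:{a..b}|lborel. f t))\<^sup>2 \<le> (b - a) * (LINT t:{a..b}|lborel. (norm (f t))\<^sup>2)"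
proof -
  have "f \<in> borel_measurable (restrict_space lborel {a..b})"
    by (intro measurable_restrict_space1) simp
  moreover have "integrable (restrict_space lborel {a..b}) (\<lambda>t. (norm (f t))\<^sup>2)"
    using f2 by (simp add: set_integrable_eq)
  ultimately show ?thesis
    using square_norm_integral_le[OF finite_measure_restrict_Icc, of f a b]
    by (simp only: measure_restrict_Icc[OF \<open>a \<le> b\<close>] set_integral_eq_restrict_space)
qed

section \<open>Hoelder estimates for paths with a weak derivative\<close>

context
  fixes T :: real and x v :: "real \<Rightarrow> config"
  assumes wd: "has_weak_deriv T x v"
begin

lemma weak_deriv_measurable: "v \<in> borel_measurable borel"
  and weak_deriv_square_integrable: "set_integrable lborel {0..T} (\<lambda>t. (norm (v t))\<^sup>2)"
  and weak_deriv_integral: "t \<in> {0..T} \<Longrightarrow> x t = x 0 + (LINT s:{0..t}|lborel. v s)"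
  using wd unfolding has_weak_deriv_def by blast+

lemma weak_deriv_integrable: "set_integrable lborel {0..T} v"
proof -
  have "v \<in> borel_measurable (restrict_space lborel {0..T})"
    by (intro measurable_restrict_space1) (simp add: weak_deriv_measurable)
  moreover have "integrable (restrict_space lborel {0..T}) (\<lambda>t. (norm (v t))\<^sup>2)"
    using weak_deriv_square_integrable by (simp add: set_integrable_eq)
  ultimately have "integrable (restrict_space lborel {0..T}) v"
    by (rule integrable_of_square_integrable[OF finite_measure_restrict_Icc])
  then show ?thesis
    by (simp add: set_integrable_eq)
qed

lemma weak_deriv_integrable_subset: "\<lbrakk>0 \<le> a; b \<le> T\<rbrakk> \<Longrightarrow> set_integrable lborel {a..b} v"
  by (rule set_integrable_subset[OF weak_deriv_integrable]) auto

lemma weak_deriv_increment: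
  assumes "0 \<le> a" "a \<le> b" "b \<le> T"
  shows "x b - x a = (LINT s:{a..b}|lborel. v s)"
proof -
  have "(LINT s:{0..a} \<union> {a..b}|lborel. v s) = (LINT s:{0..a}|lborel. v s) + (LINT s:{a..b}|lborel. v s)"
  proof (rule set_integral_Un_AE)
    show "AE s in lborel. \<not> (s \<in> {0..a} \<and> s \<in> {a..b})"
      using AE_lborel_singleton[of a] by eventually_elim auto
  qed (use assms in \<open>auto intro: weak_deriv_integrable_subset\<close>)
  moreover have "{0..a} \<union> {a..b} = {0..b}" using assms by auto
  ultimately show ?thesis using weak_deriv_integral[of a] weak_deriv_integral[of b] assms by auto
qed

text \<open>Cauchy-Schwarz applied to the increment. Loops of bounded kinetic energy are thereby
  equicontinuous, and their oscillation is controlled by the energy.\<close>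

lemma weak_deriv_Hoelder:
  assumes "0 \<le> a" "a \<le> b" "b \<le> T"
  shows "(norm (x b - x a))\<^sup>2 \<le> (b - a) * (LINT t:{0..T}|lborel. (norm (v t))\<^sup>2)"
proof -
  have sub: "set_integrable lborel {a..b} (\<lambda>t. (norm (v t))\<^sup>2)"
    by (rule set_integrable_subset[OF weak_deriv_square_integrable]) (use assms in auto)
  have "(norm (x b - x a))\<^sup>2 \<le> (b - a) * (LINT t:{a..b}|lborel. (norm (v t))\<^sup>2)"
    unfolding weak_deriv_increment[OF assms]
    by (rule square_norm_set_integral_le[OF weak_deriv_measurable assms(2) sub])
  also have "\<dots> \<le> (b - a) * (LINT t:{0..T}|lborel. (norm (v t))\<^sup>2)"
  proof (rule mult_left_mono)
    show "(LINT t:{a..b}|lborel. (norm (v t))\<^sup>2) \<le> (LINT t:{0..T}|lborel. (norm (v t))\<^sup>2)"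
      using sub weak_deriv_square_integrable assms
      unfolding set_lebesgue_integral_def set_integrable_def
      by (intro integral_mono) (auto simp: indicator_def)
  qed (use assms in simp)
  finally show ?thesis .
qed

lemma weak_deriv_Hoelder_sqrt:
  assumes "a \<in> {0..T}" "b \<in> {0..T}"
  shows "norm (x b - x a) \<le> sqrt (\<bar>b - a\<bar> * (LINT t:{0..T}|lborel. (norm (v t))\<^sup>2))"
proof (rule real_le_rsqrt)
  show "(norm (x b - x a))\<^sup>2 \<le> \<bar>b - a\<bar> * (LINT t:{0..T}|lborel. (norm (v t))\<^sup>2)"
    using weak_deriv_Hoelder[of a b] weak_deriv_Hoelder[of b a] assms
    by (cases "a \<le> b") (auto simp: norm_minus_commute)
qed

lemma weak_deriv_continuous_on: "continuous_on {0..T} x"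
proof -
  have "continuous_on {0..T} (\<lambda>t. x 0 + integral {0..t} v)"
    by (intro continuous_intros indefinite_integral_continuous_1
        set_borel_integral_eq_integral(1)[OF weak_deriv_integrable])
  moreover have "x 0 + integral {0..t} v = x t" if "t \<in> {0..T}" for t
    using weak_deriv_integral[OF that] that
      set_borel_integral_eq_integral(2)[OF weak_deriv_integrable_subset, of 0 t] by simp
  ultimately show ?thesis
    using continuous_on_cong[of "{0..T}" "{0..T}" "\<lambda>t. x 0 + integral {0..t} v" x] by simp
qed

end

text \<open>The difference of the two, extended by 0 outside \<open>{0..T}\<close>, has vanishing
  integral over every half line. Because of this the action may be computed from any weak derivative
  and not only from the one selected in \<open>weak_deriv\<close>.\<close>

lemma weak_deriv_unique:
  assumes v: "has_weak_deriv T x v" and w: "has_weak_deriv T x w"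
  shows "AE t in lborel. t \<in> {0..T} \<longrightarrow> v t = w t"
proof (cases "T \<ge> 0")
  case True
  let ?g = "\<lambda>t. indicator {0..T} t *\<^sub>R v t - indicator {0..T} t *\<^sub>R w t"
  have "AE t in lborel. ?g t = 0"
  proof (rule AE_zero_of_integral_atMost_zero)
    show "integrable lborel ?g"
      using weak_deriv_integrable[OF v] weak_deriv_integrable[OF w] by (simp add: set_integrable_def)
    fix a
    \<comment> \<open>For \<open>a < 0\<close> the interval \<open>{0..b}\<close> is empty and its
      integral is 0; otherwise \<open>b\<close> lies in \<open>{0..T}\<close>, where the defining
      equation of weak derivatives is available.\<close>
    define b where "b = min a T"
    have eq: "{..a} \<inter> {0..T} = {0..b}" by (auto simp: b_def)
    have "(LINT s:{..a}|lborel. ?g s) = (LINT s:{0..b}|lborel. v s - w s)"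
      unfolding set_lebesgue_integral_def eq[symmetric]
      by (intro Bochner_Integration.integral_cong) (auto simp: indicator_def)
    also have "\<dots> = (LINT s:{0..b}|lborel. v s) - (LINT s:{0..b}|lborel. w s)"
      by (intro set_integral_diff weak_deriv_integrable_subset[OF v] weak_deriv_integrable_subset[OF w])
         (auto simp: b_def)
    also have "\<dots> = 0"
    proof (cases "b \<ge> 0")
      case True
      then have b: "b \<in> {0..T}" by (auto simp: b_def)
      show ?thesis using weak_deriv_integral[OF v b] weak_deriv_integral[OF w b] by simp
    qed (simp add: set_lebesgue_integral_def)
    finally show "(LINT s:{..a}|lborel. ?g s) = 0" .
  qed
  then show ?thesis by eventually_elim auto
qed simp

lemma has_weak_deriv_add_scaleR:
  assumes v: "has_weak_deriv T x v" and w: "has_weak_deriv T y w"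
  shows "has_weak_deriv T (\<lambda>t. x t + c *\<^sub>R y t) (\<lambda>t. v t + c *\<^sub>R w t)"
  unfolding has_weak_deriv_def
proof (intro conjI ballI)
  note [measurable] = weak_deriv_measurable[OF v] weak_deriv_measurable[OF w]
  show "(\<lambda>t. v t + c *\<^sub>R w t) \<in> borel_measurable borel" by measurable
  have "v \<in> borel_measurable (restrict_space lborel {0..T})"
       "w \<in> borel_measurable (restrict_space lborel {0..T})"
    by (intro measurable_restrict_space1, simp)+
  then show "set_integrable lborel {0..T} (\<lambda>t. (norm (v t + c *\<^sub>R w t))\<^sup>2)"
    using weak_deriv_square_integrable[OF v] weak_deriv_square_integrable[OF w]
    by (auto simp: set_integrable_eq intro!: integrable_square_norm_add integrable_square_norm_scaleR)
  fix t assume t: "t \<in> {0..T}"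
  have "(LINT s:{0..t}|lborel. v s + c *\<^sub>R w s) = (LINT s:{0..t}|lborel. v s) + c *\<^sub>R (LINT s:{0..t}|lborel. w s)"
    using weak_deriv_integrable_subset[OF v, of 0 t] weak_deriv_integrable_subset[OF w, of 0 t] t by simp
  then show "x t + c *\<^sub>R y t = x 0 + c *\<^sub>R y 0 + (LINT s:{0..t}|lborel. v s + c *\<^sub>R w s)"
    using weak_deriv_integral[OF v t] weak_deriv_integral[OF w t] by (simp add: algebra_simps)
qed

lemma has_weak_deriv_C1:
  assumes x: "\<And>t. (x has_vector_derivative v t) (at t)" and v: "continuous_on UNIV v"
  shows "has_weak_deriv T x v"
  unfolding has_weak_deriv_def
proof (intro conjI ballI)
  show "v \<in> borel_measurable borel" by (rule borel_measurable_continuous_onI[OF v])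
  show "set_integrable lborel {0..T} (\<lambda>t. (norm (v t))\<^sup>2)"
    by (intro borel_integrable_atLeastAtMost' continuous_intros continuous_on_subset[OF v]) auto
  fix t assume t: "t \<in> {0..T}"
  have "(LINT s:{0..t}|lborel. v s) = x t - x 0"
    unfolding set_lebesgue_integral_def
    by (rule integral_FTC_atLeastAtMost)
       (use t in \<open>auto intro: has_vector_derivative_at_within[OF x] continuous_on_subset[OF v]\<close>)
  then show "x t = x 0 + (LINT s:{0..t}|lborel. v s)"
    by simp
qed

section \<open>Periodic functions on the real line\<close>

lemma periodic_int:
  fixes x :: "real \<Rightarrow> 'a"
  assumes "\<And>t. x (t + T) = x t"
  shows "x (t + of_int n * T) = x t"
proof -
  have nat: "x (t + of_nat n * T) = x t" for n t
  proof (induction n)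
    case (Suc n)
    then show ?case using assms[of "t + of_nat n * T"] by (simp add: algebra_simps)
  qed simp
  show ?thesis
  proof (cases "n \<ge> 0")
    case True
    then show ?thesis using nat[of t "nat n"] by simp
  next
    case False
    then show ?thesis using nat[of "t + of_int n * T" "nat (- n)"] by simp
  qed
qed

lemma periodic_rmod:
  fixes x :: "real \<Rightarrow> 'a"
  assumes "\<And>t. x (t + T) = x t"
  shows "x (t rmod T) = x t"
proof -
  have "[t rmod T = t] (rmod T)" by (simp add: rcong_rmod_left)
  then obtain n where "t = t rmod T + of_int n * T" unfolding rcong_altdef by blast
  then show ?thesis using periodic_int[of x T "t rmod T" n, OF assms] by simp
qed

lemma periodic_continuous:
  fixes x :: "real \<Rightarrow> 'a::topological_space"
  assumes "T > 0" and per: "\<And>t. x (t + T) = x t" and cont: "continuous_on {0..T} x"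
  shows "continuous_on UNIV x"
proof (rule continuous_at_imp_continuous_on, rule ballI)
  have shift: "continuous_on {of_int n * T..of_int (n + 1) * T} x" for n
  proof -
    have "continuous_on {of_int n * T..of_int (n + 1) * T} (\<lambda>t. x (t + of_int (- n) * T))"
      by (intro continuous_on_compose2[OF cont] continuous_intros) (auto simp: algebra_simps)
    moreover have "x (t + of_int (- n) * T) = x t" for t
      by (rule periodic_int[of x T, OF per])
    ultimately show ?thesis by (simp only:)
  qed
  fix t
  define n where "n = \<lfloor>t / T\<rfloor>"
  have "of_int n \<le> t / T" "t / T < of_int (n + 1)"
    unfolding n_def by linarith+
  then have t: "of_int n * T \<le> t" "t < of_int (n + 1) * T"
    using \<open>T > 0\<close> by (simp_all only: pos_le_divide_eq pos_divide_less_eq)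
  \<comment> \<open>The point \<open>t\<close> may be the left end of its period interval, so the
    preceding interval is glued on to obtain a neighbourhood of \<open>t\<close>.\<close>
  have "continuous_on ({of_int (n - 1) * T..of_int (n - 1 + 1) * T} \<union> {of_int n * T..of_int (n + 1) * T}) x"
    by (intro continuous_on_closed_Un closed_atLeastAtMost shift)
  then have "continuous_on {of_int (n - 1) * T<..<of_int (n + 1) * T} x"
    by (rule continuous_on_subset) auto
  moreover have "of_int (n - 1) * T < t"
    using t(1) \<open>T > 0\<close> by (simp add: algebra_simps)
  ultimately show "isCont x t"
    using t by (auto simp: continuous_on_eq_continuous_at)
qed

lemma loop_space_continuous:
  assumes "T > 0" "x \<in> loop_space T"
  shows "continuous_on UNIV x"
  using assms weak_deriv_continuous_on unfolding loop_space_def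
  by (intro periodic_continuous[of T]) auto

section \<open>The direct method\<close>

definition collision_potential :: "config \<Rightarrow> ennreal" where
  "collision_potential z = (\<Sum>(i, j)\<in>{(i, j). i < j}. 1 / ennreal (norm (z $ i - z $ j)))"

lemma measurable_collision_potential [measurable]:
  "collision_potential \<in> borel_measurable borel"
proof -
  have [measurable]: "(\<lambda>z :: config. z $ i) \<in> borel_measurable borel" for i
    by (intro borel_measurable_continuous_onI continuous_intros)
  show ?thesis
    unfolding collision_potential_def by measurable
qed

text \<open>Inversion is continuous on [0, \<infinity>], including
  \<open>1 / 0 = \<infinity>\<close>, so continuity holds at collisions too. Hence Fatou's lemma
  applies to a minimizing sequence even if its limit has collisions.\<close>

lemma tendsto_collision_potential:
  assumes "(x \<longlongrightarrow> z) F"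
  shows "((\<lambda>n. collision_potential (x n)) \<longlongrightarrow> collision_potential z) F"
proof -
  have "isCont (inverse :: ennreal \<Rightarrow> ennreal) a" for a
    using continuous_on_inverse_ennreal[of UNIV "\<lambda>x. x"] by (simp add: continuous_on_eq_continuous_at)
  then have inv: "((\<lambda>n. 1 / f n) \<longlongrightarrow> 1 / a) F" if "(f \<longlongrightarrow> a) F" for f :: "_ \<Rightarrow> ennreal" and a
    unfolding divide_ennreal_def using that by (simp add: isCont_tendsto_compose)
  then show ?thesis
    unfolding collision_potential_def split_beta
    by (intro tendsto_sum inv tendsto_ennrealI tendsto_norm tendsto_diff tendsto_vec_nth assms)
qed

lemma action_eq:
  assumes T: "T > 0" and x: "x \<in> loop_space T" and v: "has_weak_deriv T x v"
  shows "action T x = ennreal (1/2 * (LINT t:{0..T}|lborel. (norm (v t))\<^sup>2)) +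
    (\<integral>\<^sup>+ t\<in>{0..T}. collision_potential (x t) \<partial>lborel)"
proof -
  have w: "has_weak_deriv T x (weak_deriv T x)"
    unfolding weak_deriv_def by (rule someI[of "has_weak_deriv T x", OF v])
  note [measurable] = weak_deriv_measurable[OF v]
  have [measurable]: "x \<in> borel_measurable borel"
    by (rule borel_measurable_continuous_onI[OF loop_space_continuous[OF T x]])
  have kin: "(\<Sum>i\<in>UNIV. 1/2 * (norm (z $ i))\<^sup>2) = 1/2 * (norm z)\<^sup>2" for z :: config
    by (simp add: norm_vec_def L2_set_def sum_nonneg sum_distrib_left)
  have "AE t in lborel.
      (ennreal (1/2 * (norm (weak_deriv T x t))\<^sup>2) + collision_potential (x t)) * indicator {0..T} t
    = ennreal (1/2 * (norm (v t))\<^sup>2) * indicator {0..T} t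
      + collision_potential (x t) * indicator {0..T} t"
    using weak_deriv_unique[OF w v]
    by eventually_elim (auto simp: indicator_def)
  then have "action T x = (\<integral>\<^sup>+ t. ennreal (1/2 * (norm (v t))\<^sup>2) * indicator {0..T} t
      + collision_potential (x t) * indicator {0..T} t \<partial>lborel)"
    unfolding action_def kin collision_potential_def[symmetric] by (rule nn_integral_cong_AE)
  also have "\<dots> = (\<integral>\<^sup>+ t\<in>{0..T}. ennreal (1/2 * (norm (v t))\<^sup>2) \<partial>lborel) +
      (\<integral>\<^sup>+ t\<in>{0..T}. collision_potential (x t) \<partial>lborel)"
    by (rule nn_integral_add) measurable
  also have "(\<integral>\<^sup>+ t\<in>{0..T}. ennreal (1/2 * (norm (v t))\<^sup>2) \<partial>lborel)
      = (\<integral>\<^sup>+ t. ennreal (indicator {0..T} t *\<^sub>R (1/2 * (norm (v t))\<^sup>2)) \<partial>lborel)"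
    by (intro nn_integral_cong) (auto simp: indicator_def)
  also have "\<dots> = ennreal (LINT t:{0..T}|lborel. 1/2 * (norm (v t))\<^sup>2)"
    unfolding set_lebesgue_integral_def
    by (intro nn_integral_eq_integral)
       (use set_integrable_mult_right[OF weak_deriv_square_integrable[OF v], of "1/2"]
        in \<open>auto simp: set_integrable_def\<close>)
  also have "(LINT t:{0..T}|lborel. 1/2 * (norm (v t))\<^sup>2) = 1/2 * (LINT t:{0..T}|lborel. (norm (v t))\<^sup>2)"
    by (rule set_integral_mult_right)
  finally show ?thesis .
qed

text \<open>Lower semicontinuity of the kinetic energy under uniform convergence. The integrals of
  \<open>V n\<close> over \<open>{0..t}\<close> are the increments \<open>X n t - X n 0\<close>,
  which converge uniformly to \<open>x t - x 0\<close>; this is the situation of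
  \<open>square_integrable_limit\<close> with the sets \<open>{0..t}\<close>.\<close>

lemma weak_deriv_limit:
  fixes X V :: "nat \<Rightarrow> real \<Rightarrow> config"
  assumes T: "T > 0" and V: "\<And>n. has_weak_deriv T (X n) (V n)"
    and C: "\<And>n. (LINT t:{0..T}|lborel. (norm (V n t))\<^sup>2) \<le> C"
    and lim: "\<And>e. e > 0 \<Longrightarrow> \<exists>N. \<forall>n\<ge>N. \<forall>t\<in>{0..T}. norm (X n t - x t) \<le> e"
  obtains w where "has_weak_deriv T x w" "(LINT t:{0..T}|lborel. (norm (w t))\<^sup>2) \<le> C"
proof -
  let ?M = "restrict_space lborel {0..T}"
  have int: "(LINT s:{0..t}|?M. f s) = (LINT s:{0..t}|lborel. f s)" if "t \<in> {0..T}" for t and f :: "real \<Rightarrow> config"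
    using that by (subst set_integral_restrict_space)
      (auto simp: set_lebesgue_integral_def indicator_def intro!: Bochner_Integration.integral_cong)
  have V_meas: "V n \<in> borel_measurable ?M" for n
    by (intro measurable_restrict_space1) (simp add: weak_deriv_measurable[OF V])
  have V_int: "integrable ?M (\<lambda>t. (norm (V n t))\<^sup>2)" for n
    using weak_deriv_square_integrable[OF V] by (simp add: set_integrable_eq)
  have V_le: "(LINT t|?M. (norm (V n t))\<^sup>2) \<le> C" for n
    using C by (simp add: set_integral_eq_restrict_space)
  have A: "{0..t} \<in> sets ?M" if "t \<in> {0..T}" for t
    using that by (auto simp: sets_restrict_space_iff)
  have V_lim: "\<exists>N. \<forall>n\<ge>N. \<forall>t\<in>{0..T}. norm ((LINT s:{0..t}|?M. V n s) - (x t - x 0)) \<le> e"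
    if e: "e > 0" for e
  proof -
    obtain N where N: "\<And>n t. \<lbrakk>n \<ge> N; t \<in> {0..T}\<rbrakk> \<Longrightarrow> norm (X n t - x t) \<le> e / 2"
      using lim[OF half_gt_zero[OF e]] by blast
    have "norm ((LINT s:{0..t}|?M. V n s) - (x t - x 0)) \<le> e" if "n \<ge> N" "t \<in> {0..T}" for n t
    proof -
      have "X n t = X n 0 + (LINT s:{0..t}|?M. V n s)"
        unfolding int[OF that(2)] by (rule weak_deriv_integral[OF V that(2)])
      then have eq: "(LINT s:{0..t}|?M. V n s) - (x t - x 0) = (X n t - x t) - (X n 0 - x 0)"
        by (simp add: algebra_simps)
      have "norm (X n 0 - x 0) \<le> e / 2" by (rule N[OF that(1)]) (use T in simp)
      then show ?thesis
        unfolding eq using N[OF that] norm_triangle_ineq4[of "X n t - x t" "X n 0 - x 0"] by linarith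
    qed
    then show ?thesis by blast
  qed
  obtain w where w: "w \<in> borel_measurable ?M" "integrable ?M (\<lambda>t. (norm (w t))\<^sup>2)"
    "(LINT t|?M. (norm (w t))\<^sup>2) \<le> C" "\<And>t. t \<in> {0..T} \<Longrightarrow> (LINT s:{0..t}|?M. w s) = x t - x 0"
    using square_integrable_limit[where M = ?M and v = V and C = C and S = "{0..T}"
        and A = "\<lambda>t. {0..t}" and x = "\<lambda>t. x t - x 0",
        OF finite_measure_restrict_Icc V_meas V_int V_le A V_lim] by blast
  \<comment> \<open>The function \<open>w\<close> is measurable only on \<open>{0..T}\<close>;
    extension by 0 makes it Borel measurable on the line without changing any of the
    integrals.\<close>
  define w' where "w' t = indicator {0..T} t *\<^sub>R w t" for t
  have norm_w': "indicator {0..T} t *\<^sub>R (norm (w' t))\<^sup>2 = indicator {0..T} t *\<^sub>R (norm (w t))\<^sup>2" for t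
    by (simp add: w'_def indicator_def)
  show thesis
  proof
    show "(LINT t:{0..T}|lborel. (norm (w' t))\<^sup>2) \<le> C"
      unfolding set_lebesgue_integral_def norm_w' using w(3) by (simp add: integral_restrict_space)
    show "has_weak_deriv T x w'"
      unfolding has_weak_deriv_def
    proof (intro conjI ballI)
      show "w' \<in> borel_measurable borel"
        using w(1) unfolding w'_def by (subst (asm) borel_measurable_restrict_space_iff) auto
      show "set_integrable lborel {0..T} (\<lambda>t. (norm (w' t))\<^sup>2)"
        unfolding set_integrable_def norm_w' using w(2) by (simp add: integrable_restrict_space)
      fix t assume t: "t \<in> {0..T}"
      have "(LINT s:{0..t}|lborel. w' s) = (LINT s:{0..t}|lborel. w s)"
        unfolding set_lebesgue_integral_def w'_def
        using t by (intro Bochner_Integration.integral_cong) (auto simp: indicator_def)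
      also have "\<dots> = x t - x 0" using w(4)[OF t] int[OF t] by simp
      finally show "x t = x 0 + (LINT s:{0..t}|lborel. w' s)" by simp
    qed
  qed
qed

lemma loop_space_periodic: "x \<in> loop_space T \<Longrightarrow> x (t + T) = x t"
  by (simp add: loop_space_def)

text \<open>Along a minimizing sequence the kinetic energies are bounded. Then
  \<open>coercive\<close> bounds the loops and the Hoelder estimate makes them equicontinuous, so
  Arzela-Ascoli gives a uniform limit; kinetic and potential energy are both lower semicontinuous
  along it.\<close>

theorem action_minimizer_exists:
  assumes T: "T > 0" and S: "S \<subseteq> loop_space T" "S \<noteq> {}"
    and coercive: "\<And>x v t. \<lbrakk>x \<in> S; has_weak_deriv T x v; t \<in> {0..T}\<rbrakk> \<Longrightarrow>
      norm (x t) \<le> c * sqrt (LINT t:{0..T}|lborel. (norm (v t))\<^sup>2)"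
    and closed: "\<And>X x. \<lbrakk>\<And>n. X n \<in> S; \<And>t. (\<lambda>n. X n t) \<longlonglongrightarrow> x t; x \<in> loop_space T\<rbrakk> \<Longrightarrow> x \<in> S"
  shows "\<exists>x. is_min_action T S x"
proof (cases "(INF x\<in>S. action T x) = \<infinity>")
  \<comment> \<open>If the infimum is infinite, every element of \<open>S\<close> is a
    minimizer.\<close>
  case True
  then have "action T x = \<infinity>" if "x \<in> S" for x
    using that by (auto simp: INF_eq_iff top_unique dest: INF_lower[where f = "action T"])
  then show ?thesis
    using S(2) by (auto simp: is_min_action_def)
next
  case False
  define m where "m = (INF x\<in>S. action T x)"
  have m: "m \<noteq> \<infinity>" using False by (simp add: m_def)
  have "\<exists>u. (\<forall>n. u n \<in> action T ` S) \<and> u \<longlonglongrightarrow> m"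
    unfolding m_def by (rule Inf_as_limit) (use S in auto)
  then obtain u where u: "\<And>n. u n \<in> action T ` S" "u \<longlonglongrightarrow> m" by blast
  have "\<exists>x. x \<in> S \<and> u n = action T x" for n using u(1)[of n] by blast
  then obtain X0 where X0: "\<And>n. X0 n \<in> S" "\<And>n. u n = action T (X0 n)" by metis
  have X0_lim: "(\<lambda>n. action T (X0 n)) \<longlonglongrightarrow> m"
    using u(2) unfolding X0(2)[symmetric] .
  define kin where "kin v = 1/2 * (LINT t:{0..T}|lborel. (norm (v t))\<^sup>2)" for v :: "real \<Rightarrow> config"
  define U where "U x = (\<integral>\<^sup>+ t\<in>{0..T}. collision_potential (x t) \<partial>lborel)" for x
  have act: "action T x = ennreal (kin v) + U x" if "x \<in> loop_space T" "has_weak_deriv T x v" for x v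
    using action_eq[OF T that] by (simp add: kin_def U_def)
  have kin_nonneg: "0 \<le> kin v" for v
    unfolding kin_def set_lebesgue_integral_def by (simp add: integral_nonneg_AE)
  obtain M where M: "m < ennreal M" "M \<ge> 0"
  proof (cases m)
    case (real r)
    then show thesis using that[of "r + 1"] by (simp add: ennreal_less_iff)
  qed (use m in simp)
  then obtain N0 where N0: "\<And>n. n \<ge> N0 \<Longrightarrow> action T (X0 n) < ennreal M"
    using order_tendstoD(2)[OF X0_lim] by (auto simp: eventually_sequentially)
  define X1 where "X1 n = X0 (n + N0)" for n
  have X1: "X1 n \<in> S" "action T (X1 n) < ennreal M" for n
    using X0 N0 by (auto simp: X1_def)
  have X1_lim: "(\<lambda>n. action T (X1 n)) \<longlonglongrightarrow> m"
    unfolding X1_def by (rule LIMSEQ_ignore_initial_segment[OF X0_lim])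
  have "\<exists>v. has_weak_deriv T (X1 n) v" for n
    using X1(1) S(1) by (auto simp: loop_space_def)
  then obtain V1 where V1: "\<And>n. has_weak_deriv T (X1 n) (V1 n)" by metis
  have kin1: "kin (V1 n) \<in> {0..M}" for n
  proof -
    have "ennreal (kin (V1 n)) \<le> action T (X1 n)"
      using act[OF _ V1] X1(1) S(1) by (metis le_iff_add subsetD)
    then have "ennreal (kin (V1 n)) \<le> ennreal M" using X1(2)[of n] by simp
    then show ?thesis using kin_nonneg M(2) by simp
  qed
  \<comment> \<open>Once the kinetic energies converge to \<kappa>, the potential energies converge
    as well, to \<open>m - \<kappa>\<close>, and the two parts of the action can be bounded
    separately.\<close>
  obtain \<kappa> r where \<kappa>: "\<kappa> \<in> {0..M}" and r: "strict_mono r" "((\<lambda>n. kin (V1 n)) \<circ> r) \<longlonglongrightarrow> \<kappa>"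
    using compact_Icc[of 0 M, unfolded compact_def, rule_format, of "\<lambda>n. kin (V1 n)", OF kin1] by auto
  have int_le: "(LINT t:{0..T}|lborel. (norm (V1 n t))\<^sup>2) \<le> 2 * M" for n
    using kin1[of n] by (simp add: kin_def)
  have bound: "norm (X1 (r n) t) \<le> \<bar>c\<bar> * sqrt (2 * M)" if "t \<in> {0..T}" for n t
  proof -
    have "norm (X1 (r n) t) \<le> c * sqrt (LINT t:{0..T}|lborel. (norm (V1 (r n) t))\<^sup>2)"
      by (rule coercive[OF X1(1) V1 that])
    also have "\<dots> \<le> \<bar>c\<bar> * sqrt (2 * M)"
      using kin_nonneg[of "V1 (r n)"] int_le[of "r n"] by (intro mult_mono) (auto simp: kin_def)
    finally show ?thesis .
  qed
  have equi: "\<exists>d>0. \<forall>n t'. t' \<in> {0..T} \<and> norm (t - t') < d \<longrightarrow> norm (X1 (r n) t - X1 (r n) t') < e"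
    if t: "t \<in> {0..T}" and e: "e > 0" for t e
  proof (intro exI conjI allI impI)
    \<comment> \<open>The choice makes the Hoelder bound \<open>sqrt (d * (2 * M))\<close> at most
      \<open>e\<close>; the summand 1 keeps the denominator positive when
      \<open>M = 0\<close>.\<close>
    define d where "d = e\<^sup>2 / (2 * M + 1)"
    show "d > 0" using e M(2) by (simp add: d_def add_nonneg_pos)
    fix n t' assume t': "t' \<in> {0..T} \<and> norm (t - t') < d"
    have "\<bar>t - t'\<bar> * (LINT t:{0..T}|lborel. (norm (V1 (r n) t))\<^sup>2) \<le> \<bar>t - t'\<bar> * (2 * M + 1)"
      using int_le[of "r n"] by (intro mult_left_mono) auto
    also have "\<dots> < d * (2 * M + 1)"
      using t' M(2) by (intro mult_strict_right_mono) auto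
    also have "\<dots> = e\<^sup>2" using M(2) by (simp add: d_def)
    finally have "\<bar>t - t'\<bar> * (LINT t:{0..T}|lborel. (norm (V1 (r n) t))\<^sup>2) < e\<^sup>2" .
    from real_sqrt_less_mono[OF this]
    have "sqrt (\<bar>t - t'\<bar> * (LINT t:{0..T}|lborel. (norm (V1 (r n) t))\<^sup>2)) < e"
      unfolding real_sqrt_abs using e by (simp only: abs_of_pos)
    moreover have "norm (X1 (r n) t - X1 (r n) t')
        \<le> sqrt (\<bar>t - t'\<bar> * (LINT t:{0..T}|lborel. (norm (V1 (r n) t))\<^sup>2))"
      by (rule weak_deriv_Hoelder_sqrt[OF V1]) (use t t' in auto)
    ultimately show "norm (X1 (r n) t - X1 (r n) t') < e" by simp
  qed
  obtain g and k :: "nat \<Rightarrow> nat" where k: "strict_mono k"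
    and g: "\<And>e. 0 < e \<Longrightarrow> \<exists>N. \<forall>n t. n \<ge> N \<and> t \<in> {0..T} \<longrightarrow> norm (X1 (r (k n)) t - g t) < e"
  proof (rule Arzela_Ascoli[of "{0..T}" "\<lambda>n. X1 (r n)" "\<bar>c\<bar> * sqrt (2 * M)"])
    show "norm (X1 (r n) t) \<le> \<bar>c\<bar> * sqrt (2 * M)" if "t \<in> {0..T}" for n t
      by (rule bound[OF that])
    fix g and k :: "nat \<Rightarrow> nat"
    assume k: "strict_mono k"
      and g: "\<And>e. 0 < e \<Longrightarrow> \<exists>N. \<forall>n t. n \<ge> N \<and> t \<in> {0..T} \<longrightarrow> norm (X1 (r (k n)) t - g t) < e"
    show thesis by (rule that[OF k g])
  qed (use equi in auto)
  define X where "X n = X1 (r (k n))" for n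
  define V where "V n = V1 (r (k n))" for n
  have X: "X n \<in> S" "X n \<in> loop_space T" and V: "has_weak_deriv T (X n) (V n)" for n
    using X1(1) V1 S(1) by (auto simp: X_def V_def)
  have rk: "strict_mono (r \<circ> k)" using r(1) k by (rule strict_mono_o)
  have act_lim: "(\<lambda>n. action T (X n)) \<longlonglongrightarrow> m"
    using LIMSEQ_subseq_LIMSEQ[OF X1_lim rk] by (simp add: X_def o_def)
  have kin_lim: "(\<lambda>n. kin (V n)) \<longlonglongrightarrow> \<kappa>"
    using LIMSEQ_subseq_LIMSEQ[OF r(2) k] by (simp add: V_def o_def)
  have Xg: "(\<lambda>n. X n t) \<longlonglongrightarrow> g t" if "t \<in> {0..T}" for t
    unfolding LIMSEQ_iff X_def using g that by blast
  \<comment> \<open>Arzela-Ascoli provides the limit on \<open>{0..T}\<close> only, so it is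
    extended periodically. Both ends of the interval agree because each \<open>X n\<close> is
    periodic.\<close>
  define x where "x t = g (t rmod T)" for t
  have rmod: "t rmod T \<in> {0..T}" for t
    using T rmod_nonneg[of T t] rmod_less[of T t] by simp
  have Xx: "(\<lambda>n. X n t) \<longlonglongrightarrow> x t" for t
    using Xg[OF rmod[of t]] periodic_rmod[of "X _" T t] loop_space_periodic[OF X(2)] by (simp add: x_def)
  have xg: "x t = g t" if "t \<in> {0..T}" for t
    by (rule LIMSEQ_unique[OF Xx Xg[OF that]])
  have unif: "\<exists>N. \<forall>n\<ge>N. \<forall>t\<in>{0..T}. norm (X n t - x t) \<le> e" if "e > 0" for e
    using g[OF that] xg by (metis X_def less_imp_le)
  \<comment> \<open>The kinetic energies merely converge to \<kappa>, so a uniform bound holds only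
    with an error \<open>e\<close> and after dropping finitely many loops. The weak derivative
    \<open>w\<close> may depend on \<open>e\<close>, but the action does not, and \<open>e\<close>
    is sent to 0 at the end.\<close>
  have weak: "\<exists>w. has_weak_deriv T x w \<and> kin w \<le> \<kappa> + e" if e: "e > 0" for e
  proof -
    obtain N where N: "\<And>n. n \<ge> N \<Longrightarrow> kin (V n) < \<kappa> + e"
      using order_tendstoD(2)[OF kin_lim, of "\<kappa> + e"] e by (auto simp: eventually_sequentially)
    have "\<exists>N'. \<forall>n\<ge>N'. \<forall>t\<in>{0..T}. norm (X (n + N) t - x t) \<le> \<epsilon>" if "\<epsilon> > 0" for \<epsilon>
      using unif[OF that] by (meson trans_le_add1)
    moreover have "(LINT t:{0..T}|lborel. (norm (V (n + N) t))\<^sup>2) \<le> 2 * (\<kappa> + e)" for n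
      using N[of "n + N"] by (simp add: kin_def)
    ultimately obtain w where "has_weak_deriv T x w" "(LINT t:{0..T}|lborel. (norm (w t))\<^sup>2) \<le> 2 * (\<kappa> + e)"
      using weak_deriv_limit[OF T V, of "\<lambda>n. n + N" "2 * (\<kappa> + e)" x] by blast
    then show ?thesis by (auto simp: kin_def)
  qed
  have x_loop: "x \<in> loop_space T"
    unfolding loop_space_def
  proof (intro CollectI conjI allI)
    show "x (t + T) = x t" for t
      using Xx[of "t + T"] Xx[of t] loop_space_periodic[OF X(2)] LIMSEQ_unique by fastforce
    show "x t \<in> config_space" for t
    proof -
      have "(\<lambda>n. \<Sum>i\<in>UNIV. X n t $ i) \<longlonglongrightarrow> (\<Sum>i\<in>UNIV. x t $ i)"
        by (intro tendsto_sum tendsto_vec_nth Xx)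
      moreover have "(\<Sum>i\<in>UNIV. X n t $ i) = 0" for n
        using X(2)[of n] by (simp add: loop_space_def config_space_def)
      ultimately show ?thesis
        by (simp add: config_space_def LIMSEQ_const_iff)
    qed
    show "\<exists>v. has_weak_deriv T x v" using weak[of 1] by auto
  qed
  have "x \<in> S" by (rule closed[OF X(1) Xx x_loop])
  have [measurable]: "y \<in> borel_measurable borel" if "y \<in> loop_space T" for y
    by (rule borel_measurable_continuous_onI[OF loop_space_continuous[OF T that]])
  note [measurable] = this[OF X(2)]
  \<comment> \<open>Subtraction of extended nonnegative reals is truncated; this inequality is what
    allows \<kappa> and \<open>m - \<kappa>\<close> to be added up to \<open>m\<close>
    again.\<close>
  have \<kappa>_m: "ennreal \<kappa> \<le> m"
  proof (rule LIMSEQ_le[OF tendsto_ennrealI[OF kin_lim] act_lim])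
    show "\<exists>N. \<forall>n\<ge>N. ennreal (kin (V n)) \<le> action T (X n)"
      using act[OF X(2) V] by simp
  qed
  have U_lim: "(\<lambda>n. U (X n)) \<longlonglongrightarrow> m - ennreal \<kappa>"
  proof -
    have "(\<lambda>n. action T (X n) - ennreal (kin (V n))) \<longlonglongrightarrow> m - ennreal \<kappa>"
      by (rule tendsto_diff_ennreal[OF act_lim tendsto_ennrealI[OF kin_lim]]) (use m in auto)
    then show ?thesis using act[OF X(2) V] by (simp add: ennreal_add_diff_cancel_left)
  qed
  have U_le: "U x \<le> m - ennreal \<kappa>"
  proof -
    have "U x = (\<integral>\<^sup>+ t. liminf (\<lambda>n. collision_potential (X n t) * indicator {0..T} t) \<partial>lborel)"
      unfolding U_def
    proof (rule nn_integral_cong)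
      fix t
      have "(\<lambda>n. collision_potential (X n t) * indicator {0..T} t) \<longlonglongrightarrow> collision_potential (x t) * indicator {0..T} t"
        using tendsto_collision_potential[OF Xx[of t]] by (cases "t \<in> {0..T}") auto
      then show "collision_potential (x t) * indicator {0..T} t
          = liminf (\<lambda>n. collision_potential (X n t) * indicator {0..T} t)"
        by (metis lim_imp_Liminf sequentially_bot)
    qed
    also have "\<dots> \<le> liminf (\<lambda>n. U (X n))"
      unfolding U_def by (rule nn_integral_liminf) measurable
    also have "\<dots> = m - ennreal \<kappa>"
      using U_lim by (metis lim_imp_Liminf sequentially_bot)
    finally show ?thesis .
  qed
  have "action T x \<le> m"
  proof (rule ennreal_le_epsilon)
    fix e :: real assume e: "e > 0"
    obtain w where w: "has_weak_deriv T x w" "kin w \<le> \<kappa> + e" using weak[OF e] by blast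
    have "action T x = ennreal (kin w) + U x" by (rule act[OF x_loop w(1)])
    also have "\<dots> \<le> ennreal (\<kappa> + e) + (m - ennreal \<kappa>)"
      by (intro add_mono ennreal_leI w U_le)
    also have "\<dots> = (ennreal \<kappa> + (m - ennreal \<kappa>)) + ennreal e"
      using \<kappa> e by (simp add: add_ac)
    also have "ennreal \<kappa> + (m - ennreal \<kappa>) = m"
      by (rule add_diff_inverse_ennreal[OF \<kappa>_m])
    finally show "action T x \<le> m + ennreal e" .
  qed
  then have "is_min_action T S x"
    unfolding is_min_action_def m_def using \<open>x \<in> S\<close> by (auto intro: INF_lower order_trans)
  then show ?thesis by blast
qed

section \<open>Minimizers and Newton's equations\<close>

text \<open>With \<open>a = norm z\<close> and \<open>b = norm (z + h)\<close>, the inner product is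
  \<open>(b\<^sup>2 - a\<^sup>2 - (norm h)\<^sup>2) / 2\<close>, so the remainder is a rational
  function of \<open>a\<close>, \<open>b\<close> and \<open>(norm h)\<^sup>2\<close>, given by
  \<open>key\<close>. The constant comes from \<open>b \<ge> a / 2\<close>, which bounds
  \<open>(2 * a + b) / (2 * a ^ 3 * b)\<close> by \<open>5 / (2 * a ^ 3)\<close>. An upper bound is
  enough, as it only serves to estimate the action of a competitor from above.\<close>

lemma inverse_norm_upper_expansion:
  fixes z h :: "'a::real_inner"
  assumes \<delta>: "\<delta> > 0" "norm z \<ge> \<delta>" and h: "norm h \<le> \<delta> / 2"
  shows "1 / norm (z + h) \<le> 1 / norm z - (z \<bullet> h) / norm z ^ 3 + 5 / (2 * \<delta> ^ 3) * (norm h)\<^sup>2"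
proof -
  define a where "a = norm z"
  define b where "b = norm (z + h)"
  have a: "a > 0" "a \<ge> \<delta>" using \<delta> by (auto simp: a_def)
  have ba: "\<bar>b - a\<bar> \<le> norm h"
    unfolding a_def b_def using norm_triangle_ineq3[of "z + h" z] by simp
  then have b: "b \<ge> a / 2" "b > 0" using h a by auto
  have zh: "z \<bullet> h = (b\<^sup>2 - a\<^sup>2 - (norm h)\<^sup>2) / 2"
    unfolding a_def b_def power2_norm_eq_inner by (simp add: inner_add_left inner_add_right inner_commute)
  have key: "1 / a - (z \<bullet> h) / a ^ 3 - 1 / b = (norm h)\<^sup>2 / (2 * a ^ 3) - (b - a)\<^sup>2 * (2 * a + b) / (2 * a ^ 3 * b)"
    unfolding zh using a b by (simp add: divide_simps power2_eq_square power3_eq_cube) algebra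
  have "(b - a)\<^sup>2 * (2 * a + b) / (2 * a ^ 3 * b) \<le> (norm h)\<^sup>2 * (5 / (2 * \<delta> ^ 3))"
  proof -
    have 1: "(b - a)\<^sup>2 \<le> (norm h)\<^sup>2" using ba by (metis abs_ge_zero power2_abs power_mono)
    have "(2 * a + b) / (2 * a ^ 3 * b) \<le> 5 / (2 * a ^ 3)"
      using a b by (simp add: divide_simps)
    also have "\<dots> \<le> 5 / (2 * \<delta> ^ 3)"
      using a \<delta> by (intro divide_left_mono mult_left_mono power_mono) auto
    finally have 2: "(2 * a + b) / (2 * a ^ 3 * b) \<le> 5 / (2 * \<delta> ^ 3)" .
    have "(b - a)\<^sup>2 * ((2 * a + b) / (2 * a ^ 3 * b)) \<le> (norm h)\<^sup>2 * (5 / (2 * \<delta> ^ 3))"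
      using 1 2 a b by (intro mult_mono) auto
    then show ?thesis by simp
  qed
  moreover have "(norm h)\<^sup>2 / (2 * a ^ 3) \<ge> 0" using a by simp
  ultimately have "1 / b \<le> 1 / a - (z \<bullet> h) / a ^ 3 + (norm h)\<^sup>2 * (5 / (2 * \<delta> ^ 3))"
    using key by linarith
  then show ?thesis unfolding a_def b_def by (simp add: mult.commute)
qed

text \<open>Away from collisions this is the gradient of \<open>newton_potential\<close>; with unit
  masses it is also the acceleration.\<close>

definition newton_force :: "config \<Rightarrow> config" where
  "newton_force z = (\<chi> i. \<Sum>j\<in>UNIV - {i}. (1 / norm (z $ i - z $ j) ^ 3) *\<^sub>R (z $ j - z $ i))"

text \<open>Real division gives \<open>1 / 0 = 0\<close>, so this agrees with
  \<open>collision_potential\<close> only at configurations without collisions.\<close>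

definition newton_potential :: "config \<Rightarrow> real" where
  "newton_potential z = (\<Sum>(i, j)\<in>{(i, j). i < j}. 1 / norm (z $ i - z $ j))"

lemma collision_potential_eq:
  assumes "\<And>i j. i \<noteq> j \<Longrightarrow> z $ i \<noteq> z $ j"
  shows "collision_potential z = ennreal (newton_potential z)"
proof -
  have "1 / ennreal (norm (z $ i - z $ j)) = ennreal (1 / norm (z $ i - z $ j))" if "i < j" for i j
    using assms[of i j] that divide_ennreal[of 1 "norm (z $ i - z $ j)"] by simp
  then have "collision_potential z = (\<Sum>p\<in>{(i, j). i < j}. ennreal (case p of (i, j) \<Rightarrow> 1 / norm (z $ i - z $ j)))"
    unfolding collision_potential_def by (intro sum.cong) auto
  also have "\<dots> = ennreal (newton_potential z)"
    unfolding newton_potential_def by (rule sum_ennreal) auto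
  finally show ?thesis .
qed

lemma newton_potential_nonneg: "0 \<le> newton_potential z"
  unfolding newton_potential_def by (intro sum_nonneg) auto

text \<open>Action equals reaction: the contributions of (i, j) and (j, i) combine into one term per
  unordered pair, the form in which the linear terms of the pair potentials arise.\<close>

lemma inner_newton_force:
  "newton_force z \<bullet> h =
    - (\<Sum>(i, j)\<in>{(i, j). i < j}. (z $ i - z $ j) \<bullet> (h $ i - h $ j) / norm (z $ i - z $ j) ^ 3)"
proof -
  define g where "g i j = (z $ j - z $ i) \<bullet> h $ i / norm (z $ i - z $ j) ^ 3" for i j :: 4
  have "newton_force z \<bullet> h = (\<Sum>i\<in>UNIV. \<Sum>j\<in>UNIV - {i}. g i j)"
    by (simp add: inner_vec_def newton_force_def inner_sum_left g_def)
  also have "\<dots> = (\<Sum>(i, j)\<in>(SIGMA i:UNIV. UNIV - {i}). g i j)"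
    by (simp add: sum.Sigma)
  also have "(SIGMA i:UNIV. UNIV - {i}) = {(i, j). i < j} \<union> {(i, j :: 4). j < i}"
    by auto
  also have "(\<Sum>(i, j)\<in>\<dots>. g i j) = (\<Sum>(i, j)\<in>{(i, j). i < j}. g i j) + (\<Sum>(i, j)\<in>{(i, j). j < i}. g i j)"
    by (rule sum.union_disjoint) auto
  also have "(\<Sum>(i, j)\<in>{(i, j). j < i}. g i j) = (\<Sum>(i, j)\<in>{(i, j). i < j}. g j i)"
    by (rule sum.reindex_bij_witness[of _ prod.swap prod.swap]) auto
  also have "(\<Sum>(i, j)\<in>{(i, j). i < j}. g i j) + \<dots> = (\<Sum>(i, j)\<in>{(i, j). i < j}. g i j + g j i)"
    by (simp add: sum.distrib split_beta)
  also have "\<dots> = (\<Sum>(i, j)\<in>{(i, j). i < j}. - ((z $ i - z $ j) \<bullet> (h $ i - h $ j) / norm (z $ i - z $ j) ^ 3))"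
  proof (intro sum.cong refl)
    have "g i j + g j i = - ((z $ i - z $ j) \<bullet> (h $ i - h $ j) / norm (z $ i - z $ j) ^ 3)" for i j
    proof -
      have "(z $ j - z $ i) \<bullet> h $ i + (z $ i - z $ j) \<bullet> h $ j = - ((z $ i - z $ j) \<bullet> (h $ i - h $ j))"
        by (simp add: inner_diff_left inner_diff_right)
      then show ?thesis
        unfolding g_def norm_minus_commute[of "z $ j" "z $ i"] add_divide_distrib[symmetric]
        by simp
    qed
    then show "(case p of (i, j) \<Rightarrow> g i j + g j i) =
      (case p of (i, j) \<Rightarrow> - ((z $ i - z $ j) \<bullet> (h $ i - h $ j) / norm (z $ i - z $ j) ^ 3))" for p
      by (cases p) simp
  qed
  finally show ?thesis by (simp add: sum_negf split_beta)
qed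

text \<open>The pairwise expansion is applied to \<open>h $ i - h $ j\<close>, whose norm is at most
  \<open>2 * norm h\<close>. This explains the bound \<open>\<delta> / 4\<close> on
  \<open>norm h\<close>, and the factor 4 by which \<open>5 / (2 * \<delta> ^ 3)\<close> becomes
  \<open>10 / \<delta> ^ 3\<close>.\<close>

lemma newton_potential_upper_expansion:
  assumes \<delta>: "\<delta> > 0" "\<And>i j. i \<noteq> j \<Longrightarrow> norm (z $ i - z $ j) \<ge> \<delta>" and h: "norm h \<le> \<delta> / 4"
  shows "newton_potential (z + h) \<le> newton_potential z + newton_force z \<bullet> h +
    real (card {(i :: 4, j :: 4). i < j}) * (10 / \<delta> ^ 3) * (norm h)\<^sup>2"
proof -
  let ?P = "{(i :: 4, j :: 4). i < j}"
  have "newton_potential (z + h) \<le> (\<Sum>(i, j)\<in>?P. 1 / norm (z $ i - z $ j)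
      - (z $ i - z $ j) \<bullet> (h $ i - h $ j) / norm (z $ i - z $ j) ^ 3 + 10 / \<delta> ^ 3 * (norm h)\<^sup>2)"
    unfolding newton_potential_def
  proof (intro sum_mono, clarify)
    fix i j :: 4 assume "i < j"
    have hij: "norm (h $ i - h $ j) \<le> 2 * norm h"
      using norm_triangle_ineq4[of "h $ i" "h $ j"] Finite_Cartesian_Product.norm_nth_le[of h i]
        Finite_Cartesian_Product.norm_nth_le[of h j] by linarith
    then have sq: "(norm (h $ i - h $ j))\<^sup>2 \<le> 4 * (norm h)\<^sup>2"
      using power_mono[OF hij norm_ge_zero, of 2] by (simp add: power_mult_distrib)
    have "1 / norm ((z $ i - z $ j) + (h $ i - h $ j)) \<le> 1 / norm (z $ i - z $ j)
        - (z $ i - z $ j) \<bullet> (h $ i - h $ j) / norm (z $ i - z $ j) ^ 3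
        + 5 / (2 * \<delta> ^ 3) * (norm (h $ i - h $ j))\<^sup>2"
      by (rule inverse_norm_upper_expansion) (use \<delta> \<open>i < j\<close> hij h in auto)
    moreover have "5 / (2 * \<delta> ^ 3) * (norm (h $ i - h $ j))\<^sup>2 \<le> 5 / (2 * \<delta> ^ 3) * (4 * (norm h)\<^sup>2)"
      using sq \<delta>(1) by (intro mult_left_mono) auto
    moreover have "(z + h) $ i - (z + h) $ j = (z $ i - z $ j) + (h $ i - h $ j)"
      by (simp add: algebra_simps)
    moreover have "5 / (2 * \<delta> ^ 3) * (4 * (norm h)\<^sup>2) = 10 / \<delta> ^ 3 * (norm h)\<^sup>2"
      by simp
    ultimately show "1 / norm ((z + h) $ i - (z + h) $ j) \<le> 1 / norm (z $ i - z $ j)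
      - (z $ i - z $ j) \<bullet> (h $ i - h $ j) / norm (z $ i - z $ j) ^ 3 + 10 / \<delta> ^ 3 * (norm h)\<^sup>2"
      by (simp only:)
  qed
  also have "\<dots> = newton_potential z + newton_force z \<bullet> h + real (card ?P) * (10 / \<delta> ^ 3) * (norm h)\<^sup>2"
    unfolding inner_newton_force newton_potential_def
    by (simp add: split_beta sum.distrib sum_subtractf)
  finally show ?thesis .
qed

text \<open>The function \<eta> has only a weak derivative, so no pointwise product rule is used.
  Instead \<open>f t \<bullet> u s\<close> is integrated over the triangle \<open>s \<le> t\<close>
  in both orders: one order produces the increments of \<eta>, the other those of
  \<open>w\<close>.\<close>

lemma weak_deriv_integration_by_parts:
  assumes T: "T > 0" and u: "has_weak_deriv T \<eta> u"
    and w: "\<And>t. (w has_vector_derivative f t) (at t)" and f: "continuous_on UNIV f"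
  shows "(LINT t:{0..T}|lborel. f t \<bullet> \<eta> t) + (LINT t:{0..T}|lborel. w t \<bullet> u t) = w T \<bullet> \<eta> T - w 0 \<bullet> \<eta> 0"
proof -
  define f0 where "f0 t = indicator {0..T} t *\<^sub>R f t" for t
  define u0 where "u0 t = indicator {0..T} t *\<^sub>R u t" for t
  have cont_w: "continuous_on A w" for A
    using w by (meson continuous_at_imp_continuous_on has_vector_derivative_continuous)
  have f0_int: "integrable lborel f0"
    using borel_integrable_atLeastAtMost'[OF continuous_on_subset[OF f]]
    unfolding f0_def set_integrable_def by simp
  have u0_int: "integrable lborel u0"
    using weak_deriv_integrable[OF u] unfolding u0_def set_integrable_def .
  have [measurable]: "f0 \<in> borel_measurable borel" "u0 \<in> borel_measurable borel"
    using f0_int u0_int by (auto dest: borel_measurable_integrable)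
  have bound: "integrable (lborel \<Otimes>\<^sub>M lborel) (\<lambda>(t, s). norm (f0 t) * norm (u0 s))"
  proof (rule lborel_pair.Fubini_integrable)
    show "integrable lborel (\<lambda>t. LINT s|lborel. norm (case (t, s) of (t, s) \<Rightarrow> norm (f0 t) * norm (u0 s)))"
      using f0_int by simp
  qed (use u0_int in auto)
  define G where "G t s = (if s \<le> t then f0 t \<bullet> u0 s else 0)" for t s
  have G_int: "integrable (lborel \<Otimes>\<^sub>M lborel) (\<lambda>(t, s). G t s)"
  proof (rule Bochner_Integration.integrable_bound[OF bound])
    show "(\<lambda>(t, s). G t s) \<in> borel_measurable (lborel \<Otimes>\<^sub>M lborel)"
      unfolding G_def by measurable
    show "AE p in lborel \<Otimes>\<^sub>M lborel. norm (case p of (t, s) \<Rightarrow> G t s)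
        \<le> norm (case p of (t, s) \<Rightarrow> norm (f0 t) * norm (u0 s))"
      by (intro AE_I2) (auto simp: G_def Cauchy_Schwarz_ineq2)
  qed
  have inner1: "(LINT s|lborel. G t s) = indicator {0..T} t *\<^sub>R (f t \<bullet> (\<eta> t - \<eta> 0))" for t
  proof (cases "t \<in> {0..T}")
    case True
    have "(LINT s|lborel. G t s) = (LINT s|lborel. f t \<bullet> (indicator {0..t} s *\<^sub>R u s))"
      using True by (intro Bochner_Integration.integral_cong) (auto simp: G_def f0_def u0_def indicator_def)
    also have "\<dots> = f t \<bullet> (LINT s:{0..t}|lborel. u s)"
      using weak_deriv_integrable_subset[OF u, of 0 t] True
      unfolding set_lebesgue_integral_def set_integrable_def by (intro integral_inner_right) auto
    finally show ?thesis using weak_deriv_integral[OF u True] True by simp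
  next
    case False
    then have "G t s = 0" for s by (auto simp: G_def f0_def indicator_def)
    then show ?thesis using False by simp
  qed
  have inner2: "(LINT t|lborel. G t s) = indicator {0..T} s *\<^sub>R ((w T - w s) \<bullet> u s)" for s
  proof (cases "s \<in> {0..T}")
    case True
    have "(LINT t|lborel. G t s) = (LINT t|lborel. (indicator {s..T} t *\<^sub>R f t) \<bullet> u s)"
      using True by (intro Bochner_Integration.integral_cong) (auto simp: G_def f0_def u0_def indicator_def)
    also have "\<dots> = (LINT t:{s..T}|lborel. f t) \<bullet> u s"
      using borel_integrable_atLeastAtMost'[OF continuous_on_subset[OF f], of s T]
      unfolding set_lebesgue_integral_def set_integrable_def by (intro integral_inner_left) auto
    also have "(LINT t:{s..T}|lborel. f t) = w T - w s"
      unfolding set_lebesgue_integral_def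
      by (rule integral_FTC_atLeastAtMost)
        (use True in \<open>auto intro: has_vector_derivative_at_within[OF w] continuous_on_subset[OF f]\<close>)
    finally show ?thesis using True by simp
  next
    case False
    then have "G t s = 0" for t by (auto simp: G_def u0_def indicator_def)
    then show ?thesis using False by simp
  qed
  have cont_\<eta>: "continuous_on {0..T} \<eta>" by (rule weak_deriv_continuous_on[OF u])
  have i1: "set_integrable lborel {0..T} (\<lambda>t. f t \<bullet> \<eta> t)"
    and i2: "set_integrable lborel {0..T} (\<lambda>t. f t \<bullet> \<eta> 0)"
    by (intro borel_integrable_atLeastAtMost' continuous_intros cont_\<eta> continuous_on_subset[OF f]; simp)+
  have [measurable]: "u \<in> borel_measurable borel" by (rule weak_deriv_measurable[OF u])
  have [measurable]: "w \<in> borel_measurable borel" by (rule borel_measurable_continuous_onI[OF cont_w])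
  have "bounded (w ` {0..T})" by (intro compact_imp_bounded compact_continuous_image cont_w) simp
  then obtain B where B: "\<And>t. t \<in> {0..T} \<Longrightarrow> norm (w t) \<le> B"
    unfolding bounded_iff by (meson imageI)
  have i3: "set_integrable lborel {0..T} (\<lambda>t. w t \<bullet> u t)"
    unfolding set_integrable_def
  proof (rule Bochner_Integration.integrable_bound)
    show "integrable lborel (\<lambda>t. B * norm (u0 t))" using u0_int by auto
    show "AE t in lborel. norm (indicator {0..T} t *\<^sub>R (w t \<bullet> u t)) \<le> norm (B * norm (u0 t))"
    proof (intro AE_I2)
      fix t
      have "\<bar>w t \<bullet> u t\<bar> \<le> \<bar>B\<bar> * norm (u t)" if "t \<in> {0..T}"
        using Cauchy_Schwarz_ineq2[of "w t" "u t"] B[OF that]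
        by (smt (verit) mult_right_mono norm_ge_zero)
      then show "norm (indicator {0..T} t *\<^sub>R (w t \<bullet> u t)) \<le> norm (B * norm (u0 t))"
        by (auto simp: indicator_def u0_def abs_mult)
    qed
  qed measurable
  have i4: "set_integrable lborel {0..T} (\<lambda>t. w T \<bullet> u t)"
    using weak_deriv_integrable[OF u] unfolding set_integrable_def
    by (simp flip: inner_scaleR_right)
  have "(LINT s|lborel. (LINT t|lborel. G t s)) = (LINT t|lborel. (LINT s|lborel. G t s))"
    by (rule lborel_pair.Fubini_integral[OF G_int])
  then have "(LINT s:{0..T}|lborel. (w T - w s) \<bullet> u s) = (LINT t:{0..T}|lborel. f t \<bullet> (\<eta> t - \<eta> 0))"
    unfolding inner1 inner2 set_lebesgue_integral_def .
  then have "(LINT s:{0..T}|lborel. w T \<bullet> u s) - (LINT s:{0..T}|lborel. w s \<bullet> u s)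
      = (LINT t:{0..T}|lborel. f t \<bullet> \<eta> t) - (LINT t:{0..T}|lborel. f t \<bullet> \<eta> 0)"
    using i1 i2 i3 i4 by (simp add: inner_diff_left inner_diff_right)
  moreover have "(LINT s:{0..T}|lborel. w T \<bullet> u s) = w T \<bullet> (\<eta> T - \<eta> 0)"
    using weak_deriv_integrable[OF u] weak_deriv_integral[OF u, of T] T
    unfolding set_lebesgue_integral_def set_integrable_def
    by (simp flip: inner_scaleR_right)
  moreover have "(LINT t:{0..T}|lborel. f t \<bullet> \<eta> 0) = (w T - w 0) \<bullet> \<eta> 0"
  proof -
    have "(LINT t:{0..T}|lborel. f t) = w T - w 0"
      unfolding set_lebesgue_integral_def
      by (rule integral_FTC_atLeastAtMost)
        (use T in \<open>auto intro: has_vector_derivative_at_within[OF w] continuous_on_subset[OF f]\<close>)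
    then show ?thesis
      using f0_int unfolding set_lebesgue_integral_def f0_def
      by (simp flip: inner_scaleR_left)
  qed
  ultimately show ?thesis by (simp add: inner_diff_left inner_diff_right)
qed

section \<open>Variation of the action at a collision-free loop\<close>

lemma continuous_newton_force:
  assumes "continuous_on A x" "collision_free x"
  shows "continuous_on A (\<lambda>t. newton_force (x t))"
  unfolding newton_force_def
  by (intro continuous_intros assms(1)) (use assms(2) in \<open>auto simp: collision_free_def\<close>)

lemma continuous_newton_potential:
  assumes "continuous_on A x" "collision_free x"
  shows "continuous_on A (\<lambda>t. newton_potential (x t))"
  unfolding newton_potential_def split_beta
  by (intro continuous_intros assms(1)) (use assms(2) in \<open>auto simp: collision_free_def\<close>)

lemma collision_free_separated:
  assumes "T > 0" "continuous_on {0..T} x" "collision_free x"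
  obtains \<delta> where "\<delta> > 0" "\<And>t i j. \<lbrakk>t \<in> {0..T}; i \<noteq> j\<rbrakk> \<Longrightarrow> norm (x t $ i - x t $ j) \<ge> \<delta>"
proof -
  have "\<exists>d>0. \<forall>t\<in>{0..T}. norm (x t $ fst p - x t $ snd p) \<ge> d" if "fst p \<noteq> snd p" for p
  proof -
    have "\<exists>s\<in>{0..T}. \<forall>t\<in>{0..T}. norm (x s $ fst p - x s $ snd p) \<le> norm (x t $ fst p - x t $ snd p)"
      using assms(1) by (intro continuous_attains_inf continuous_intros assms(2)) auto
    then obtain s where "s \<in> {0..T}"
      "\<And>t. t \<in> {0..T} \<Longrightarrow> norm (x s $ fst p - x s $ snd p) \<le> norm (x t $ fst p - x t $ snd p)" by blast
    moreover have "norm (x s $ fst p - x s $ snd p) > 0"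
      using assms(3) that by (auto simp: collision_free_def)
    ultimately show ?thesis by blast
  qed
  then obtain d where d: "\<And>p. fst p \<noteq> snd p \<Longrightarrow> d p > 0"
    "\<And>p t. \<lbrakk>fst p \<noteq> snd p; t \<in> {0..T}\<rbrakk> \<Longrightarrow> norm (x t $ fst p - x t $ snd p) \<ge> d p" by metis
  let ?D = "insert 1 (d ` {p. fst p \<noteq> snd p})"
  show thesis
  proof
    show "Min ?D > 0" using d(1) by auto
    fix t i j assume t: "t \<in> {0..T}" and ij: "i \<noteq> (j :: 4)"
    have "Min ?D \<le> d (i, j)" using ij by (intro Min_le) auto
    also have "\<dots> \<le> norm (x t $ i - x t $ j)" using d(2)[of "(i, j)" t] t ij by simp
    finally show "Min ?D \<le> norm (x t $ i - x t $ j)" .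
  qed
qed

lemma loop_space_add_scaleR:
  assumes "x \<in> loop_space T" "y \<in> loop_space T"
  shows "(\<lambda>t. x t + c *\<^sub>R y t) \<in> loop_space T"
  using assms has_weak_deriv_add_scaleR[of T x _ y _ c]
  by (auto simp: loop_space_def config_space_def sum.distrib simp flip: scaleR_right.sum)

text \<open>A du Bois-Reymond argument with the single direction \<open>\<eta> = x - y\<close>.
  Moving from \<open>x\<close> to \<open>x - e *\<^sub>R \<eta>\<close> lowers the action by
  \<open>e * D\<close> to first order, where \<open>D\<close> is the integral of
  \<open>(norm (u t))\<^sup>2\<close> and \<open>u\<close> the weak derivative of \<eta>. The error
  is quadratic in \<open>e\<close>, so minimality forces \<open>D = 0\<close>.\<close>

theorem minimizer_eq_second_primitive:
  assumes T: "T > 0" and x: "x \<in> loop_space T" "collision_free x"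
    and y: "y \<in> loop_space T" "\<And>t. (y has_vector_derivative w t) (at t)"
    and w: "\<And>t. (w has_vector_derivative newton_force (x t)) (at t)" "w T = w 0"
    and min: "\<And>e. action T x \<le> action T (\<lambda>t. x t + e *\<^sub>R (x t - y t))"
  shows "\<exists>c. \<forall>t. x t = y t + c"
proof -
  obtain v where v: "has_weak_deriv T x v" using x(1) by (auto simp: loop_space_def)
  have cont_x: "continuous_on A x" for A
    using loop_space_continuous[OF T x(1)] by (rule continuous_on_subset) simp
  have cont_w: "continuous_on A w" for A
    using w by (meson continuous_at_imp_continuous_on has_vector_derivative_continuous)
  define F where "F t = newton_force (x t)" for t
  have cont_F: "continuous_on A F" for A
    unfolding F_def by (rule continuous_newton_force[OF cont_x x(2)])
  define \<eta> where "\<eta> t = x t - y t" for t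
  define u where "u t = v t - w t" for t
  have \<eta>_loop: "\<eta> \<in> loop_space T"
    using loop_space_add_scaleR[OF x(1) y(1), of "-1"] by (simp add: \<eta>_def[abs_def])
  have u: "has_weak_deriv T \<eta> u"
    using has_weak_deriv_add_scaleR[OF v has_weak_deriv_C1[OF y(2) cont_w], of "-1"]
    by (simp add: \<eta>_def[abs_def] u_def[abs_def])
  have cont_\<eta>: "continuous_on A \<eta>" for A
    using loop_space_continuous[OF T \<eta>_loop] by (rule continuous_on_subset) simp
  obtain \<delta> where \<delta>: "\<delta> > 0" "\<And>t i j. \<lbrakk>t \<in> {0..T}; i \<noteq> j\<rbrakk> \<Longrightarrow> norm (x t $ i - x t $ j) \<ge> \<delta>"
    using collision_free_separated[OF T cont_x x(2)] by metis
  have "bounded (\<eta> ` {0..T})"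
    by (intro compact_imp_bounded compact_continuous_image cont_\<eta>) simp
  then obtain C0 where "\<And>t. t \<in> {0..T} \<Longrightarrow> norm (\<eta> t) \<le> C0"
    unfolding bounded_iff by (meson imageI)
  then obtain C where C: "C > 0" "\<And>t. t \<in> {0..T} \<Longrightarrow> norm (\<eta> t) \<le> C"
    by (meson less_le_trans max.cobounded1 max.cobounded2 order_trans zero_less_one)
  define K where "K = real (card {(i :: 4, j :: 4). i < j}) * (10 / \<delta> ^ 3)"
  have K: "K \<ge> 0" using \<delta>(1) by (simp add: K_def)
  define A where "A = (LINT t:{0..T}|lborel. (norm (v t))\<^sup>2)"
  define B where "B = (LINT t:{0..T}|lborel. v t \<bullet> u t)"
  define D where "D = (LINT t:{0..T}|lborel. (norm (u t))\<^sup>2)"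
  define J where "J = (LINT t:{0..T}|lborel. F t \<bullet> \<eta> t)"
  define P where "P = (LINT t:{0..T}|lborel. newton_potential (x t))"
  have meas: "v \<in> borel_measurable (restrict_space lborel {0..T})"
      "u \<in> borel_measurable (restrict_space lborel {0..T})"
      "w \<in> borel_measurable (restrict_space lborel {0..T})"
    using weak_deriv_measurable[OF v] weak_deriv_measurable[OF u] borel_measurable_continuous_onI[OF cont_w]
    by (auto intro!: measurable_restrict_space1)
  have sq: "set_integrable lborel {0..T} (\<lambda>t. (norm (w t))\<^sup>2)"
    by (intro borel_integrable_atLeastAtMost' continuous_intros cont_w)
  have vu: "set_integrable lborel {0..T} (\<lambda>t. v t \<bullet> u t)"
    and wu: "set_integrable lborel {0..T} (\<lambda>t. w t \<bullet> u t)"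
    using integrable_inner_of_square_integrable[OF meas(1,2)] integrable_inner_of_square_integrable[OF meas(3,2)]
      weak_deriv_square_integrable[OF v] weak_deriv_square_integrable[OF u] sq
    by (simp_all add: set_integrable_eq)
  note v2 = weak_deriv_square_integrable[OF v] and u2 = weak_deriv_square_integrable[OF u]
  have F\<eta>: "set_integrable lborel {0..T} (\<lambda>t. F t \<bullet> \<eta> t)"
    by (intro borel_integrable_atLeastAtMost' continuous_intros cont_F cont_\<eta>)
  have npot: "set_integrable lborel {0..T} (\<lambda>t. newton_potential (x t))"
    by (intro borel_integrable_atLeastAtMost' continuous_newton_potential cont_x x(2))
  \<comment> \<open>\<open>B + J\<close> is the first variation in the direction \<eta>, up to sign
    conventions already built into \<open>J\<close>: integration by parts turns \<open>J\<close>
    into minus the integral of \<open>w \<bullet> u\<close>, the boundary terms cancelling as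
    \<open>w\<close> and \<eta> agree at the two ends of the period.\<close>
  have D_eq: "B + J = D"
  proof -
    have "D = (LINT t:{0..T}|lborel. v t \<bullet> u t - w t \<bullet> u t)"
      unfolding D_def by (simp add: power2_norm_eq_inner u_def inner_diff_left)
    also have "\<dots> = B - (LINT t:{0..T}|lborel. w t \<bullet> u t)"
      unfolding B_def by (rule set_integral_diff(2)[OF vu wu])
    also have "(LINT t:{0..T}|lborel. w t \<bullet> u t) = - J"
      using weak_deriv_integration_by_parts[OF T u w(1)] cont_F[of UNIV] w(2)
        loop_space_periodic[OF \<eta>_loop, of 0] by (simp add: F_def[abs_def] J_def)
    finally show ?thesis by simp
  qed
  have nonneg: "0 \<le> (LINT t:{0..T}|lborel. f t)" if "\<And>t. 0 \<le> f t" for f :: "real \<Rightarrow> real"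
    unfolding set_lebesgue_integral_def by (rule integral_nonneg_AE) (simp add: that)
  have toennreal: "(\<integral>\<^sup>+t\<in>{0..T}. ennreal (f t) \<partial>lborel) = ennreal (LINT t:{0..T}|lborel. f t)"
    if "set_integrable lborel {0..T} f" "\<And>t. t \<in> {0..T} \<Longrightarrow> 0 \<le> f t" for f
  proof -
    have "(\<integral>\<^sup>+t\<in>{0..T}. ennreal (f t) \<partial>lborel) = (\<integral>\<^sup>+t. ennreal (indicator {0..T} t *\<^sub>R f t) \<partial>lborel)"
      by (intro nn_integral_cong) (auto simp: indicator_def)
    also have "\<dots> = ennreal (LINT t:{0..T}|lborel. f t)"
      unfolding set_lebesgue_integral_def
      by (rule nn_integral_eq_integral) (use that in \<open>auto simp: set_integrable_def indicator_def\<close>)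
    finally show ?thesis .
  qed
  have action_x: "action T x = ennreal (1/2 * A + P)"
  proof -
    have "action T x = ennreal (1/2 * A) + (\<integral>\<^sup>+t\<in>{0..T}. ennreal (newton_potential (x t)) \<partial>lborel)"
      unfolding action_eq[OF T x(1) v] A_def
      using collision_potential_eq x(2) by (simp add: collision_free_def)
    also have "\<dots> = ennreal (1/2 * A + P)"
      unfolding P_def toennreal[OF npot newton_potential_nonneg]
      by (rule ennreal_plus[symmetric]) (auto simp: A_def intro: nonneg newton_potential_nonneg)
    finally show ?thesis .
  qed
  \<comment> \<open>The comparison of \<open>x\<close> with \<open>x - e *\<^sub>R \<eta>\<close>,
    divided by \<open>e\<close>. The bound on \<open>e * C\<close> keeps the perturbation within the
    range of the expansion of the potential and away from collisions.\<close>
  have D_le: "D \<le> e * (1/2 * D + K * C\<^sup>2 * T)" if e: "e > 0" "e * C \<le> \<delta> / 4" for e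
  proof -
    define z where "z t = x t + (- e) *\<^sub>R \<eta> t" for t
    define R where "R t = newton_potential (x t) - e * (F t \<bullet> \<eta> t) + K * (e * C)\<^sup>2" for t
    have z_loop: "z \<in> loop_space T" and z_wd: "has_weak_deriv T z (\<lambda>t. v t + (- e) *\<^sub>R u t)"
      unfolding z_def[abs_def]
      by (rule loop_space_add_scaleR[OF x(1) \<eta>_loop], rule has_weak_deriv_add_scaleR[OF v u])
    have small: "norm ((- e) *\<^sub>R \<eta> t) \<le> e * C" if "t \<in> {0..T}" for t
      using C(2)[OF that] e by simp
    \<comment> \<open>Freedom from collisions is needed because only then is the potential in the
      action of \<open>z\<close> given by the real-valued \<open>newton_potential\<close>.\<close>
    have z_free: "z t $ i \<noteq> z t $ j" if t: "t \<in> {0..T}" and ij: "i \<noteq> j" for t i j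
    proof
      assume "z t $ i = z t $ j"
      then have "x t $ i - x t $ j = e *\<^sub>R (\<eta> t $ i) - e *\<^sub>R (\<eta> t $ j)"
        by (simp add: z_def algebra_simps)
      also have "norm \<dots> \<le> norm (e *\<^sub>R \<eta> t) + norm (e *\<^sub>R \<eta> t)"
        using norm_triangle_ineq4[of "e *\<^sub>R (\<eta> t $ i)" "e *\<^sub>R (\<eta> t $ j)"]
          Finite_Cartesian_Product.norm_nth_le[of "e *\<^sub>R \<eta> t" i]
          Finite_Cartesian_Product.norm_nth_le[of "e *\<^sub>R \<eta> t" j] by simp
      also have "\<dots> \<le> \<delta> / 2"
        using order_trans[OF small[OF t] e(2)] by (simp only: norm_scaleR abs_minus_cancel)
      finally show False using \<delta>(2)[OF t ij] \<delta>(1) by linarith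
    qed
    have R_ge: "newton_potential (z t) \<le> R t" if t: "t \<in> {0..T}" for t
    proof -
      have "newton_potential (z t) \<le> newton_potential (x t) + newton_force (x t) \<bullet> ((- e) *\<^sub>R \<eta> t)
          + K * (norm ((- e) *\<^sub>R \<eta> t))\<^sup>2"
        unfolding z_def K_def
        by (rule newton_potential_upper_expansion[OF \<delta>(1) \<delta>(2)[OF t] order_trans[OF small[OF t] e(2)]])
      also have "\<dots> \<le> R t"
        using power_mono[OF small[OF t], of 2] K by (simp add: R_def F_def mult_left_mono)
      finally show ?thesis .
    qed
    have R_int: "set_integrable lborel {0..T} R"
      unfolding R_def
      by (intro borel_integrable_atLeastAtMost' continuous_intros continuous_newton_potential cont_x x(2) cont_F cont_\<eta>)
    have R_nonneg: "0 \<le> R t" if "t \<in> {0..T}" for t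
      using R_ge[OF that] newton_potential_nonneg[of "z t"] by linarith
    have R_eq: "(LINT t:{0..T}|lborel. R t) = P - e * J + K * (e * C)\<^sup>2 * T"
    proof -
      have "set_integrable lborel {0..T} (\<lambda>t. K * (e * C)\<^sup>2)" by (intro borel_integrable_atLeastAtMost' continuous_intros)
      moreover have "(LINT t:{0..T}|lborel. K * (e * C)\<^sup>2) = K * (e * C)\<^sup>2 * T"
        using T by (subst set_integral_const) auto
      ultimately show ?thesis
        unfolding R_def P_def J_def using npot F\<eta>
        by (simp add: set_integral_add(2) set_integral_diff(2) set_integral_add(1) set_integral_diff(1))
    qed
    have kin_eq: "(LINT t:{0..T}|lborel. (norm (v t + (- e) *\<^sub>R u t))\<^sup>2) = A - 2 * e * B + e\<^sup>2 * D"
    proof -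
      have "(norm (v t + (- e) *\<^sub>R u t))\<^sup>2 = (norm (v t))\<^sup>2 - (2 * e) * (v t \<bullet> u t) + e\<^sup>2 * (norm (u t))\<^sup>2" for t
        unfolding power2_norm_eq_inner
        by (simp add: inner_add_left inner_add_right inner_diff_left inner_diff_right inner_commute power2_eq_square algebra_simps)
      then show ?thesis
        unfolding A_def B_def D_def using v2 u2 vu
        by (simp add: set_integral_add(2) set_integral_diff(2) set_integral_add(1) set_integral_diff(1))
    qed
    have kin_nonneg: "0 \<le> 1/2 * (A - 2 * e * B + e\<^sup>2 * D)"
      unfolding kin_eq[symmetric] using nonneg[of "\<lambda>t. (norm (v t + (- e) *\<^sub>R u t))\<^sup>2"] by simp
    have pot_nonneg: "0 \<le> P - e * J + K * (e * C)\<^sup>2 * T"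
      unfolding R_eq[symmetric] set_lebesgue_integral_def
      by (rule integral_nonneg_AE) (use R_nonneg in \<open>auto simp: indicator_def\<close>)
    have R_nn: "(\<integral>\<^sup>+t\<in>{0..T}. ennreal (R t) \<partial>lborel) = ennreal (LINT t:{0..T}|lborel. R t)"
      by (rule toennreal[OF R_int]) (rule R_nonneg)
    have "action T z \<le> ennreal (1/2 * (A - 2 * e * B + e\<^sup>2 * D)) + (\<integral>\<^sup>+t\<in>{0..T}. ennreal (R t) \<partial>lborel)"
      unfolding action_eq[OF T z_loop z_wd] kin_eq
    proof (intro add_left_mono nn_integral_mono)
      show "collision_potential (z t) * indicator {0..T} t \<le> ennreal (R t) * indicator {0..T} t" for t
        using collision_potential_eq[OF z_free] R_ge by (auto simp: indicator_def ennreal_leI)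
    qed
    also have "\<dots> = ennreal (1/2 * (A - 2 * e * B + e\<^sup>2 * D) + (P - e * J + K * (e * C)\<^sup>2 * T))"
      unfolding R_nn R_eq by (rule ennreal_plus[symmetric, OF kin_nonneg pot_nonneg])
    finally have le: "ennreal (1/2 * A + P) \<le>
        ennreal (1/2 * (A - 2 * e * B + e\<^sup>2 * D) + (P - e * J + K * (e * C)\<^sup>2 * T))"
      using min[of "- e"] unfolding action_x[symmetric] z_def \<eta>_def by (rule order_trans[rotated])
    then have "1/2 * A + P \<le> 1/2 * (A - 2 * e * B + e\<^sup>2 * D) + (P - e * J + K * (e * C)\<^sup>2 * T)"
      using ennreal_le_iff[OF add_nonneg_nonneg[OF kin_nonneg pot_nonneg]] by blast
    then have "e * (B + J) \<le> e * (e * (1/2 * D + K * C\<^sup>2 * T))"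
      by (simp add: algebra_simps power2_eq_square)
    then show ?thesis using e(1) D_eq by (simp only: mult_le_cancel_left_pos)
  qed
  have "D \<le> 0"
  proof (rule field_le_epsilon)
    fix \<epsilon> :: real assume \<epsilon>: "\<epsilon> > 0"
    define Q where "Q = 1/2 * D + K * C\<^sup>2 * T + 1"
    have Q: "Q > 0"
      using nonneg[of "\<lambda>t. (norm (u t))\<^sup>2"] K T by (simp add: Q_def D_def add_nonneg_pos)
    \<comment> \<open>The first entry ensures \<open>e * C \<le> \<delta> / 4\<close>, the second
      \<open>e * Q \<le> \<epsilon>\<close>; the summand 1 in \<open>Q\<close> makes it
      positive.\<close>
    define e where "e = min (\<delta> / (4 * C)) (\<epsilon> / Q)"
    have "e > 0" using \<delta>(1) C(1) \<epsilon> Q by (simp add: e_def)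
    have "e * C \<le> \<delta> / (4 * C) * C" using C(1) by (intro mult_right_mono) (auto simp: e_def)
    then have "e * C \<le> \<delta> / 4" using C(1) by simp
    have "D \<le> e * (1/2 * D + K * C\<^sup>2 * T)" by (rule D_le) fact+
    also have "\<dots> \<le> e * Q" using \<open>e > 0\<close> by (simp add: Q_def)
    also have "\<dots> \<le> \<epsilon> / Q * Q" using Q by (intro mult_right_mono) (auto simp: e_def)
    finally show "D \<le> 0 + \<epsilon>" using Q by simp
  qed
  then have "D = 0" using nonneg[of "\<lambda>t. (norm (u t))\<^sup>2"] by (simp add: D_def)
  then have "AE t in lborel. indicator {0..T} t *\<^sub>R (norm (u t))\<^sup>2 = 0"
    using u2 unfolding D_def set_lebesgue_integral_def set_integrable_def
    by (subst (asm) integral_nonneg_eq_0_iff_AE) auto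
  then have u0: "AE t in lborel. t \<in> {0..T} \<longrightarrow> u t = 0"
    by eventually_elim auto
  have \<eta>0: "\<eta> t = \<eta> 0" if t: "t \<in> {0..T}" for t
  proof -
    have "AE s in lborel. indicator {0..t} s *\<^sub>R u s = 0"
      using u0 by eventually_elim (use t in \<open>auto simp: indicator_def\<close>)
    then have "(LINT s:{0..t}|lborel. u s) = 0"
      unfolding set_lebesgue_integral_def by (rule integral_eq_zero_AE)
    then show ?thesis using weak_deriv_integral[OF u t] by simp
  qed
  have "\<eta> t = \<eta> 0" for t
    using \<eta>0[of "t rmod T"] periodic_rmod[of \<eta> T t] loop_space_periodic[OF \<eta>_loop]
      rmod_nonneg[of T t] rmod_less[of T t] T by simp
  then have "x t = y t + \<eta> 0" for t by (metis \<eta>_def add.commute diff_add_cancel)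
  then show ?thesis by blast
qed

lemma newton_solutionI:
  assumes "\<And>t. (x has_vector_derivative w t) (at t)"
    and "\<And>t. (w has_vector_derivative newton_force (x t)) (at t)"
  shows "newton_solution x"
  unfolding newton_solution_def
proof (intro exI allI conjI)
  fix t i
  show "(x has_vector_derivative w t) (at t)" by fact
  have "((\<lambda>s. w s $ i) has_vector_derivative newton_force (x t) $ i) (at t)"
    by (rule bounded_linear.has_vector_derivative[OF bounded_linear_vec_nth assms(2)])
  then show "((\<lambda>s. w s $ i) has_vector_derivative
      (\<Sum>j\<in>UNIV - {i}. (1 / norm (x t $ i - x t $ j) ^ 3) *\<^sub>R (x t $ j - x t $ i))) (at t)"
    by (simp add: newton_force_def)
qed

section \<open>The symmetry group\<close>

lemma group_sym_grp: "L > 0 \<Longrightarrow> group (sym_grp L)"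
  unfolding sym_grp_def by (intro DirProd_group group_dihedral_group group_integer_mod_group)

lemma carrier_sym_grp: "carrier (sym_grp L) = ({0..<int L} \<times> UNIV) \<times> {0..<2}"
  by (simp add: sym_grp_def dihedral_group_def carrier_integer_mod_group)

lemma mult_sym_grp:
  "((k, e), m) \<otimes>\<^bsub>sym_grp L\<^esub> ((k', e'), m') =
    (((k + (if e then - k' else k')) mod int L, e \<noteq> e'), (m + m') mod 2)"
  by (simp add: sym_grp_def dihedral_group_def)

lemma one_sym_grp: "\<one>\<^bsub>sym_grp L\<^esub> = ((0, False), 0)"
  by (simp add: sym_grp_def dihedral_group_def)

lemma generators_in_sym_grp:
  assumes "L > 1"
  shows "h1 \<in> carrier (sym_grp L)" "h2 \<in> carrier (sym_grp L)" "h3 \<in> carrier (sym_grp L)"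
  using assms by (auto simp: carrier_sym_grp h1_def h2_def h3_def)

lemma inv_generators_sym_grp:
  assumes "L > 1"
  shows "inv\<^bsub>sym_grp L\<^esub> h1 = h1" "inv\<^bsub>sym_grp L\<^esub> h2 = h2" "inv\<^bsub>sym_grp L\<^esub> h3 = h3"
proof -
  have "group (sym_grp L)" using assms by (simp add: group_sym_grp)
  note inv = group.inv_equality[OF this]
  show "inv\<^bsub>sym_grp L\<^esub> h1 = h1" "inv\<^bsub>sym_grp L\<^esub> h2 = h2" "inv\<^bsub>sym_grp L\<^esub> h3 = h3"
    by (rule inv; use generators_in_sym_grp[OF assms] in
        \<open>simp add: h1_def h2_def h3_def mult_sym_grp one_sym_grp\<close>)+
qed

text \<open>The rotation \<open>r\<close> is \<open>h2 h1\<close>, its powers times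
  \<open>h1\<close> are the reflections, and \<open>h3\<close> supplies the other factor. Products
  suffice, without inverses or a case for the identity, because the generators are involutions and
  the identity is \<open>h1 h1\<close>.\<close>

lemma sym_grp_induct:
  assumes L: "L > 1" and g: "g \<in> carrier (sym_grp L)"
    and gens: "P h1" "P h2" "P h3"
    and mult: "\<And>a b. \<lbrakk>a \<in> carrier (sym_grp L); b \<in> carrier (sym_grp L); P a; P b\<rbrakk> \<Longrightarrow> P (a \<otimes>\<^bsub>sym_grp L\<^esub> b)"
  shows "P g"
proof -
  note mem = generators_in_sym_grp[OF L]
  have r: "((1, False), 0) = h2 \<otimes>\<^bsub>sym_grp L\<^esub> h1"
    using L by (simp add: h1_def h2_def mult_sym_grp)
  have "P ((1, False), 0)" unfolding r by (rule mult) (use mem gens in auto)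
  have rot: "P ((int k, False), 0)" if "k < L" for k
    using that
  proof (induction k)
    case 0
    have "((int 0, False), 0) = h1 \<otimes>\<^bsub>sym_grp L\<^esub> h1"
      by (simp add: h1_def mult_sym_grp)
    then show ?case using mult[OF mem(1) mem(1) gens(1) gens(1)] by simp
  next
    case (Suc k)
    have "((int (Suc k), False), 0) = ((1, False), 0) \<otimes>\<^bsub>sym_grp L\<^esub> ((int k, False), 0)"
      using Suc.prems by (simp add: mult_sym_grp)
    also have "P \<dots>"
      by (rule mult) (use Suc L \<open>P ((1, False), 0)\<close> in \<open>auto simp: carrier_sym_grp\<close>)
    finally show ?case .
  qed
  have dih: "P ((k, e), 0)" if k: "k \<in> {0..<int L}" for k e
  proof (cases e)
    case False
    then show ?thesis using rot[of "nat k"] k by auto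
  next
    case True
    have "((k, e), 0) = ((k, False), 0) \<otimes>\<^bsub>sym_grp L\<^esub> h1"
      using True k by (simp add: h1_def mult_sym_grp)
    also have "P \<dots>"
      by (rule mult) (use mem gens rot[of "nat k"] k in \<open>auto simp: carrier_sym_grp\<close>)
    finally show ?thesis .
  qed
  obtain k e m where g': "g = ((k, e), m)" "k \<in> {0..<int L}" "m = 0 \<or> m = 1"
    using g by (force simp: carrier_sym_grp)
  show ?thesis
  proof (cases "m = 0")
    case True
    then show ?thesis using dih g' by simp
  next
    case False
    then have "g = ((k, e), 0) \<otimes>\<^bsub>sym_grp L\<^esub> h3"
      using g' by (simp add: h3_def mult_sym_grp)
    also have "P \<dots>"
      by (rule mult) (use mem gens dih g' in \<open>auto simp: carrier_sym_grp\<close>)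
    finally show ?thesis .
  qed
qed

text \<open>The inverses in the time and index arguments undo the reversal of order caused by
  composition, so this is a left action. The inner reduction modulo \<open>T\<close> has no effect,
  as \<tau> takes values in \<open>{0..<T}\<close>.\<close>

lemma loop_act_mult:
  assumes \<tau>: "group_action G {0..<T} \<tau>" and \<rho>: "group_action G UNIV \<rho>" and \<sigma>: "group_action G UNIV \<sigma>"
    and T: "T > 0" and g: "g \<in> carrier G" and h: "h \<in> carrier G"
  shows "loop_act G T \<tau> \<rho> \<sigma> (g \<otimes>\<^bsub>G\<^esub> h) x = loop_act G T \<tau> \<rho> \<sigma> g (loop_act G T \<tau> \<rho> \<sigma> h x)"
proof
  fix t
  have G: "group G" using \<tau> by (simp add: group_action_def group_hom_def)
  have inv: "inv\<^bsub>G\<^esub> g \<in> carrier G" "inv\<^bsub>G\<^esub> h \<in> carrier G"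
    using G g h by (auto intro: group.inv_closed)
  have t: "t rmod T \<in> {0..<T}" using T rmod_nonneg[of T t] rmod_less[of T t] by simp
  define s where "s = \<tau> (inv\<^bsub>G\<^esub> g) (t rmod T)"
  have s: "s \<in> {0..<T}"
    using group_action.element_image[OF \<tau> inv(1) t] by (simp add: s_def)
  have "\<tau> (inv\<^bsub>G\<^esub> (g \<otimes>\<^bsub>G\<^esub> h)) (t rmod T) = \<tau> (inv\<^bsub>G\<^esub> h) s"
    unfolding s_def group.inv_mult_group[OF G g h]
    by (rule group_action.composition_rule[OF \<tau> t inv(2) inv(1)])
  moreover have "s rmod T = s" using s by simp
  moreover have "config_act \<rho> \<sigma> (g \<otimes>\<^bsub>G\<^esub> h) z = config_act \<rho> \<sigma> g (config_act \<rho> \<sigma> h z)" for z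
  proof -
    have bij: "bij (\<sigma> a)" if "a \<in> carrier G" for a
      using group_action.surj_prop[OF \<sigma> that] group_action.inj_prop[OF \<sigma> that] by (simp add: bij_def)
    have "\<sigma> (g \<otimes>\<^bsub>G\<^esub> h) = \<sigma> g \<circ> \<sigma> h"
      using group_action.composition_rule[OF \<sigma> UNIV_I g h] by (simp add: fun_eq_iff)
    then have "inv_into UNIV (\<sigma> (g \<otimes>\<^bsub>G\<^esub> h)) = inv_into UNIV (\<sigma> h) \<circ> inv_into UNIV (\<sigma> g)"
      using o_inv_distrib[OF bij[OF g] bij[OF h]] by simp
    then show ?thesis
      using group_action.composition_rule[OF \<rho> UNIV_I g h] by (simp add: config_act_def vec_eq_iff)
  qed
  ultimately show "loop_act G T \<tau> \<rho> \<sigma> (g \<otimes>\<^bsub>G\<^esub> h) x t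
      = loop_act G T \<tau> \<rho> \<sigma> g (loop_act G T \<tau> \<rho> \<sigma> h x) t"
    unfolding loop_act_def by (simp add: s_def)
qed

lemma fixed_loops_sym_grp:
  assumes "T > 0" "L > 1" and \<tau>: "group_action (sym_grp L) {0..<T} \<tau>"
    and \<rho>: "group_action (sym_grp L) UNIV \<rho>" and \<sigma>: "group_action (sym_grp L) UNIV \<sigma>"
  shows "fixed_loops (sym_grp L) T \<tau> \<rho> \<sigma> =
    {x \<in> loop_space T. \<forall>g\<in>{h1, h2, h3}. loop_act (sym_grp L) T \<tau> \<rho> \<sigma> g x = x}"
proof -
  have "loop_act (sym_grp L) T \<tau> \<rho> \<sigma> g x = x"
    if "\<forall>g\<in>{h1, h2, h3}. loop_act (sym_grp L) T \<tau> \<rho> \<sigma> g x = x" "g \<in> carrier (sym_grp L)" for g x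
    using assms(2) that(2)
    by (rule sym_grp_induct) (use that(1) loop_act_mult[OF \<tau> \<rho> \<sigma> assms(1)] in auto)
  then show ?thesis
    unfolding fixed_loops_def using generators_in_sym_grp[OF assms(2)] by blast
qed

lemma loop_act_involution_fixed_iff:
  assumes T: "T > 0" and per: "\<And>t. x (t + T) = x t"
    and inv: "inv\<^bsub>G\<^esub> g = g" and \<tau>: "\<forall>t\<in>{0..<T}. \<tau> g t = (a * t + b) rmod T" and a: "a \<in> {1, - 1}"
    and \<sigma>: "\<sigma> g \<circ> \<sigma> g = id"
  shows "loop_act G T \<tau> \<rho> \<sigma> g x = x \<longleftrightarrow> (\<forall>t i. x t $ i = \<rho> g (x (a * t + b) $ \<sigma> g i))"
proof -
  have "inv_into UNIV (\<sigma> g) = \<sigma> g"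
    using \<sigma> by (rule inv_unique_comp[OF _ \<sigma>])
  moreover have "x (\<tau> g (t rmod T)) = x (a * t + b)" for t
  proof -
    have "x (\<tau> g (t rmod T)) = x (a * (t rmod T) + b)"
      using \<tau> T rmod_nonneg[of T t] rmod_less[of T t] periodic_rmod[of x T, OF per] by simp
    also have "\<dots> = x (a * t + b)"
    proof (rule periodic_rmod[of "\<lambda>t. x (a * t + b)" T])
      show "x (a * (t + T) + b) = x (a * t + b)" for t
        using a per[of "t + b"] per[of "- t - T + b"] by (auto simp: algebra_simps)
    qed
    finally show ?thesis .
  qed
  ultimately have "loop_act G T \<tau> \<rho> \<sigma> g x t = (\<chi> i. \<rho> g (x (a * t + b) $ \<sigma> g i))" for t
    by (simp add: loop_act_def config_act_def inv)
  then have "loop_act G T \<tau> \<rho> \<sigma> g x = x \<longleftrightarrow> (\<forall>t i. \<rho> g (x (a * t + b) $ \<sigma> g i) = x t $ i)"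
    by (simp only: fun_eq_iff vec_eq_iff vec_lambda_beta)
  also have "\<dots> \<longleftrightarrow> (\<forall>t i. x t $ i = \<rho> g (x (a * t + b) $ \<sigma> g i))"
    by (intro iff_allI eq_commute)
  finally show ?thesis .
qed

section \<open>Reflections of the plane in complex notation\<close>

lemma line_reflection_eq:
  assumes "u \<noteq> 0"
  shows "line_reflection u z = u / cnj u * cnj z"
proof -
  have "complex_of_real (u \<bullet> u) = u * cnj u"
    by (simp add: complex_norm_square[symmetric] dot_square_norm)
  moreover have "complex_of_real (2 * (z \<bullet> u)) = z * cnj u + cnj z * u"
    by (simp add: complex_eq_iff inner_complex_def)
  ultimately have "line_reflection u z = (z * cnj u + cnj z * u) / (u * cnj u) * u - z"
    unfolding line_reflection_def scaleR_conv_of_real of_real_divide by simp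
  also have "\<dots> = u / cnj u * cnj z"
    using assms by (simp add: field_simps)
  finally show ?thesis .
qed

text \<open>For the unit number \<open>w = sgn l2 * cnj (sgn l1)\<close>, whose argument is the
  oriented angle from \<open>l1\<close> to \<open>l2\<close>, the expression is
  \<open>w ^ 4\<close>. If it were 1, then \<open>w\<close> would be one of 1, -1,
  \<open>\<i>\<close>, \<open>- \<i>\<close>, so \<open>\<bar>Re w\<bar>\<close> would be 0 or 1;
  but it equals \<open>cos (pi / q)\<close>, which lies strictly between for
  \<open>q > 2\<close>.\<close>

lemma line_reflections_rotation_neq_1:
  fixes q :: nat
  assumes l: "l1 \<noteq> 0" "l2 \<noteq> 0" "line_angle l1 l2 = pi / real q" and q: "q > 2"
  shows "(l2 / cnj l2 * cnj (l1 / cnj l1))\<^sup>2 \<noteq> 1"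
proof
  define w where "w = sgn l2 * cnj (sgn l1)"
  have sgn: "u / cnj u = (sgn u)\<^sup>2" if "u \<noteq> 0" for u :: complex
  proof -
    have "(complex_of_real (norm u))\<^sup>2 = u * cnj u"
      using complex_norm_square[of u] by simp
    then have "(sgn u)\<^sup>2 = u\<^sup>2 / (u * cnj u)"
      by (simp only: sgn_eq power_divide)
    then show ?thesis using that by (simp add: power2_eq_square)
  qed
  have norm_w: "norm w = 1" using l by (simp add: w_def norm_mult norm_sgn)
  have Re_w: "\<bar>Re w\<bar> = \<bar>l1 \<bullet> l2\<bar> / (norm l1 * norm l2)"
    by (simp add: w_def sgn_eq inner_complex_def abs_mult field_simps flip: add_divide_distrib)
  have "\<bar>l1 \<bullet> l2\<bar> / (norm l1 * norm l2) \<le> 1"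
    using Cauchy_Schwarz_ineq2[of l1 l2] l by (simp add: divide_le_eq_1)
  then have Re_cos: "\<bar>Re w\<bar> = cos (pi / real q)"
    unfolding Re_w l(3)[symmetric] line_angle_def by (subst cos_arccos) (auto intro: order_trans[of _ 0])
  have "0 < pi / real q" "pi / real q < pi / 2" using q by (auto simp: field_simps)
  moreover from this have "pi / real q \<le> pi" by linarith
  ultimately have "0 < cos (pi / real q)" "cos (pi / real q) < 1"
    using cos_gt_zero[of "pi / real q"] cos_monotone_0_pi[of 0 "pi / real q"] by auto
  then have Re01: "0 < \<bar>Re w\<bar>" "\<bar>Re w\<bar> < 1" using Re_cos by auto
  assume "(l2 / cnj l2 * cnj (l1 / cnj l1))\<^sup>2 = 1"
  moreover have "l2 / cnj l2 * cnj (l1 / cnj l1) = w\<^sup>2"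
    unfolding w_def by (simp only: sgn[OF l(1)] sgn[OF l(2)] power_mult_distrib complex_cnj_power)
  ultimately have "(w\<^sup>2)\<^sup>2 = 1" by simp
  then have "(w\<^sup>2 - 1) * (w\<^sup>2 + 1) = 0" by (simp add: algebra_simps power2_eq_square)
  then have "w\<^sup>2 - 1 = 0 \<or> w\<^sup>2 + 1 = 0" by (simp only: mult_eq_0_iff)
  moreover have "w\<^sup>2 - 1 = (w - 1) * (w + 1)" "w\<^sup>2 + 1 = (w - \<i>) * (w + \<i>)"
    by (simp_all add: algebra_simps power2_eq_square)
  ultimately have "w = 1 \<or> w = - 1 \<or> w = \<i> \<or> w = - \<i>"
    by (simp only: mult_eq_0_iff right_minus_eq eq_neg_iff_add_eq_0 disj_assoc)
  then show False using Re01 by auto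
qed

section \<open>Symmetric loops\<close>

lemma has_vector_derivative_vec_lambda:
  assumes "\<And>i. ((\<lambda>t. f t $ i) has_vector_derivative f' $ i) (at t)"
  shows "(f has_vector_derivative (f' :: config)) (at t)"
proof -
  have axis: "bounded_linear (axis i :: complex \<Rightarrow> config)" for i
    by (intro linear_conv_bounded_linear[THEN iffD1] linearI)
       (simp_all add: axis_def vec_eq_iff)
  have sum_axis: "(\<Sum>i\<in>UNIV. axis i (z $ i)) = z" for z :: config
    by (simp add: vec_eq_iff axis_def sum.delta)
  have "((\<lambda>t. \<Sum>i\<in>UNIV. axis i (f t $ i)) has_vector_derivative (\<Sum>i\<in>UNIV. axis i (f' $ i))) (at t)"
    by (intro has_vector_derivative_sum bounded_linear.has_vector_derivative[OF axis] assms)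
  then show ?thesis by (simp only: sum_axis)
qed

section \<open>Primitives of functions that are periodic up to a rotation\<close>

lemma has_vector_derivative_real_affine:
  assumes "\<And>t. (g has_vector_derivative f t) (at t)"
  shows "((\<lambda>t. g (a * t + b)) has_vector_derivative a *\<^sub>R f (a * t + b)) (at (t :: real))"
  by (rule vector_diff_chain_at[of "\<lambda>t. a * t + b" a t g, unfolded o_def])
     (auto intro!: derivative_eq_intros assms simp: has_real_derivative_iff_has_vector_derivative[symmetric])

lemma has_vector_derivative_zero_imp_const:
  fixes g :: "real \<Rightarrow> 'a::real_normed_vector"
  assumes "\<And>t. (g has_vector_derivative 0) (at t)"
  shows "g s = g t"
  using has_derivative_zero_constant[of UNIV g] assms
  by (force simp: has_vector_derivative_def)

text \<open>The difference is a constant \<open>k\<close> with \<open>k = \<omega> * k\<close>,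
  hence 0. This is the means of carrying symmetries from a function over to its primitive.\<close>

lemma twisted_primitive_unique:
  fixes \<omega> :: complex
  assumes "\<omega> \<noteq> 1"
    and g: "\<And>t. (g has_vector_derivative f t) (at t)" "\<And>t. g t = \<omega> * g (t - s)"
    and h: "\<And>t. (h has_vector_derivative f t) (at t)" "\<And>t. h t = \<omega> * h (t - s)"
  shows "g = h"
proof
  fix t
  have "((\<lambda>t. g t - h t) has_vector_derivative 0) (at t)" for t
    using has_vector_derivative_diff[OF g(1) h(1), of t] by simp
  then have "g t - h t = g (t - s) - h (t - s)"
    by (rule has_vector_derivative_zero_imp_const)
  moreover have "g t - h t = \<omega> * (g (t - s) - h (t - s))"
    using g(2)[of t] h(2)[of t] by (simp add: right_diff_distrib)
  ultimately have "(\<omega> - 1) * (g t - h t) = 0" by (simp add: left_diff_distrib)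
  then show "g t = h t" using \<open>\<omega> \<noteq> 1\<close> by simp
qed

text \<open>For any primitive \<open>g0\<close> the twisted relation holds up to a constant
  \<open>d\<close>, and subtracting \<open>d / (1 - \<omega>)\<close> removes it. Periodicity then
  follows from uniqueness, applied to the translate of \<open>g\<close> by \<open>T\<close>.\<close>

lemma twisted_primitive_exists:
  fixes \<omega> :: complex
  assumes "\<omega> \<noteq> 1" and f: "continuous_on UNIV f" "\<And>t. f (t + T) = f t" "\<And>t. f t = \<omega> * f (t - s)"
  obtains g where "\<And>t. (g has_vector_derivative f t) (at t)" "\<And>t. g (t + T) = g t"
    "\<And>t. g t = \<omega> * g (t - s)"
proof -
  obtain g0 where g0: "\<And>t. (g0 has_vector_derivative f t) (at t)"
    using einterval_antiderivative[of "-\<infinity>" "\<infinity>" f] f(1) by (auto simp: continuous_on_eq_continuous_at)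
  have shift: "((\<lambda>t. g0 (t + b)) has_vector_derivative f (t + b)) (at t)" for b t
    using has_vector_derivative_real_affine[of g0 f 1 b t] g0 by simp
  define d where "d = g0 0 - \<omega> * g0 (- s)"
  have d: "g0 t - \<omega> * g0 (t - s) = d" for t
  proof -
    have "((\<lambda>t. g0 t - \<omega> * g0 (t + - s)) has_vector_derivative f t - \<omega> * f (t + - s)) (at t)" for t
      by (intro has_vector_derivative_diff g0 has_vector_derivative_mult_right shift)
    moreover have "f t - \<omega> * f (t + - s) = 0" for t
      using f(3)[of t] by simp
    ultimately have "((\<lambda>t. g0 t - \<omega> * g0 (t - s)) has_vector_derivative 0) (at t)" for t
      by (simp only: add_uminus_conv_diff)
    then show ?thesis
      unfolding d_def using has_vector_derivative_zero_imp_const[of "\<lambda>t. g0 t - \<omega> * g0 (t - s)" t 0] by simp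
  qed
  define k where "k = d / (1 - \<omega>)"
  have k: "(1 - \<omega>) * k = d" using \<open>\<omega> \<noteq> 1\<close> by (simp add: k_def)
  define g where "g t = g0 t - k" for t
  have g': "(g has_vector_derivative f t) (at t)" for t
    using has_vector_derivative_diff[OF g0 has_vector_derivative_const] by (simp add: g_def[abs_def])
  have g_tw: "g t = \<omega> * g (t - s)" for t
  proof -
    have "g0 t - \<omega> * g0 (t - s) = (1 - \<omega>) * k" using d[of t] k by simp
    then show ?thesis by (simp add: g_def algebra_simps)
  qed
  have "(\<lambda>t. g (t + T)) = g"
  proof (rule twisted_primitive_unique[OF \<open>\<omega> \<noteq> 1\<close> _ _ g' g_tw])
    show "((\<lambda>t. g (t + T)) has_vector_derivative f t) (at t)" for t
      using has_vector_derivative_real_affine[of g f 1 T t] g' f(2) by simp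
    show "g (t + T) = \<omega> * g (t - s + T)" for t
      using g_tw[of "t + T"] by (simp add: algebra_simps)
  qed
  then have "g (t + T) = g t" for t by (metis)
  then show thesis using that g' g_tw by blast
qed

text \<open>Equal masses admit every permutation of the bodies, and the pair forces depend only on
  differences and their norms. Linear isometries over the reals are allowed so that reflections,
  which are not complex linear, are covered.\<close>

lemma newton_force_equivariant:
  assumes z: "\<And>i. z $ i = A (z' $ p i)" and p: "bij p" and A: "linear A" "\<And>u. norm (A u) = norm u"
  shows "newton_force z $ i = A (newton_force z' $ p i)"
proof -
  have "newton_force z $ i = (\<Sum>j\<in>UNIV - {i}. A ((1 / norm (z' $ p i - z' $ p j) ^ 3) *\<^sub>R (z' $ p j - z' $ p i)))"
    by (simp add: newton_force_def z linear_scale[OF A(1)] A(2) flip: linear_diff[OF A(1)])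
  also have "\<dots> = (\<Sum>j\<in>UNIV - {p i}. A ((1 / norm (z' $ p i - z' $ j) ^ 3) *\<^sub>R (z' $ j - z' $ p i)))"
  proof (rule sum.reindex_bij_betw)
    show "bij_betw p (UNIV - {i}) (UNIV - {p i})"
      using p image_set_diff[of p UNIV "{i}"] by (simp add: bij_def bij_betw_def inj_on_diff)
  qed
  also have "\<dots> = A (newton_force z' $ p i)"
    by (simp add: newton_force_def linear_sum[OF A(1)])
  finally show ?thesis .
qed

text \<open>Here \<kappa> stands for \<open>T / L\<close>, the maps
  \<open>z \<mapsto> c1 * cnj z\<close> and \<open>z \<mapsto> c2 * cnj z\<close> are the two
  reflections, and \<open>c2 * cnj c1\<close> is the rotation by which \<open>h2 h1\<close>
  acts.\<close>

locale symmetric_loops =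
  fixes T \<kappa> :: real and c1 c2 :: complex and p1 p2 :: "4 \<Rightarrow> 4"
  assumes T: "T > 0" and \<kappa>: "0 < \<kappa>" "2 * \<kappa> \<le> T"
    and c: "norm c1 = 1" "norm c2 = 1" "(c2 * cnj c1)\<^sup>2 \<noteq> 1"
    and p1: "p1 = Transposition.transpose 1 2 \<circ> Transposition.transpose 3 4"
    and p2: "p2 = Transposition.transpose 1 3 \<circ> Transposition.transpose 2 4"
begin

text \<open>The three equations express invariance under \<open>h1\<close>, \<open>h2\<close> and
  \<open>h3\<close>. The last one uses \<open>p1\<close> as well, since \<open>h1\<close> and
  \<open>h3\<close> permute the bodies alike.\<close>

definition loops :: "(real \<Rightarrow> config) set" where
  "loops = {x \<in> loop_space T. \<forall>t i. x t $ i = c1 * cnj (x (- t) $ p1 i) \<and>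
    x t $ i = c2 * cnj (x (\<kappa> - t) $ p2 i) \<and> x t $ i = - x t $ p1 i}"

abbreviation \<omega> :: complex where "\<omega> \<equiv> (c2 * cnj c1)\<^sup>2"

lemma distinct_4: "(1::4) \<noteq> 2" "(1::4) \<noteq> 3" "(1::4) \<noteq> 4" "(2::4) \<noteq> 3" "(2::4) \<noteq> 4" "(3::4) \<noteq> 4"
  by simp_all

lemma perms: "p1 1 = 2" "p1 2 = 1" "p1 3 = 4" "p1 4 = 3" "p2 1 = 3" "p2 3 = 1" "p2 2 = 4" "p2 4 = 2"
  using distinct_4 by (auto simp: p1 p2 Transposition.transpose_def)

lemma perm_inv: "p1 (p1 i) = i" "p2 (p2 i) = i" "p1 (p2 (p1 (p2 i))) = i"
  using exhaust_4[of i] perms by auto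

lemma bij_perm: "bij p1" "bij p2"
  by (rule o_bij[of p1 p1] o_bij[of p2 p2]; simp add: fun_eq_iff perm_inv)+

lemma norm_\<omega>: "norm \<omega> = 1" and \<omega>_cnj: "\<omega> * cnj \<omega> = 1"
proof -
  show "norm \<omega> = 1" using c by (simp add: norm_mult norm_power)
  then show "\<omega> * cnj \<omega> = 1" using complex_norm_square[of \<omega>] by simp
qed

lemma loopsD:
  assumes "x \<in> loops"
  shows "x \<in> loop_space T" "x t $ i = c1 * cnj (x (- t) $ p1 i)"
    "x t $ i = c2 * cnj (x (\<kappa> - t) $ p2 i)" "x t $ i = - x t $ p1 i"
  using assms unfolding loops_def by blast+

text \<open>Combining the two reflections shifts time by \<kappa> and permutes the bodies by
  \<open>p1 \<circ> p2\<close>, that is (1 4)(2 3). Doing so twice brings every body back to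
  itself.\<close>

lemma loops_twisted:
  assumes x: "x \<in> loops"
  shows "x t $ i = \<omega> * x (t - 2 * \<kappa>) $ i"
proof -
  have step: "x t $ i = (c2 * cnj c1) * x (t - \<kappa>) $ p1 (p2 i)" for t i
    using loopsD(3)[OF x, of t i] loopsD(2)[OF x, of "\<kappa> - t" "p2 i"] by simp
  show ?thesis
    using step[of t i] step[of "t - \<kappa>" "p1 (p2 i)"] perm_inv by (simp add: power2_eq_square algebra_simps)
qed

lemma loops_add_scaleR:
  assumes "x \<in> loops" "y \<in> loops"
  shows "(\<lambda>t. x t + e *\<^sub>R y t) \<in> loops"
  unfolding loops_def
proof (intro CollectI conjI allI)
  show "(\<lambda>t. x t + e *\<^sub>R y t) \<in> loop_space T"
    by (rule loop_space_add_scaleR[OF loopsD(1)[OF assms(1)] loopsD(1)[OF assms(2)]])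
  fix t i
  show "(x t + e *\<^sub>R y t) $ i = c1 * cnj ((x (- t) + e *\<^sub>R y (- t)) $ p1 i)"
    using loopsD(2)[OF assms(1), of t i] loopsD(2)[OF assms(2), of t i] by (simp add: algebra_simps)
  show "(x t + e *\<^sub>R y t) $ i = c2 * cnj ((x (\<kappa> - t) + e *\<^sub>R y (\<kappa> - t)) $ p2 i)"
    using loopsD(3)[OF assms(1), of t i] loopsD(3)[OF assms(2), of t i] by (simp add: algebra_simps)
  show "(x t + e *\<^sub>R y t) $ i = - (x t + e *\<^sub>R y t) $ p1 i"
    using loopsD(4)[OF assms(1), of t i] loopsD(4)[OF assms(2), of t i] by (simp add: algebra_simps)
qed

lemma loops_closed:
  assumes X: "\<And>n. X n \<in> loops" and lim: "\<And>t. (\<lambda>n. X n t) \<longlonglongrightarrow> x t" and x: "x \<in> loop_space T"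
  shows "x \<in> loops"
  unfolding loops_def
proof (intro CollectI conjI allI x)
  fix t i
  note nth = tendsto_vec_nth[OF lim]
  show "x t $ i = c1 * cnj (x (- t) $ p1 i)"
    by (rule LIMSEQ_unique[OF nth[of t i]], subst loopsD(2)[OF X]) (intro tendsto_intros nth)
  show "x t $ i = c2 * cnj (x (\<kappa> - t) $ p2 i)"
    by (rule LIMSEQ_unique[OF nth[of t i]], subst loopsD(3)[OF X]) (intro tendsto_intros nth)
  show "x t $ i = - x t $ p1 i"
    by (rule LIMSEQ_unique[OF nth[of t i]], subst loopsD(4)[OF X]) (intro tendsto_intros nth)
qed

text \<open>The twisted relation at \<open>2 * \<kappa>\<close>, a time in \<open>{0..T}\<close>,
  reads \<open>(\<omega> - 1) * x 0 $ i = (x (2 * \<kappa>) - x 0) $ i\<close>, so the starting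
  point is bounded by the oscillation, and the oscillation by the energy. The factor 4 counts the
  bodies.\<close>

lemma loops_coercive:
  assumes x: "x \<in> loops" and v: "has_weak_deriv T x v" and t: "t \<in> {0..T}"
  shows "norm (x t) \<le> ((4 / norm (\<omega> - 1) + 1) * sqrt T) * sqrt (LINT t:{0..T}|lborel. (norm (v t))\<^sup>2)"
proof -
  define V where "V = sqrt T * sqrt (LINT t:{0..T}|lborel. (norm (v t))\<^sup>2)"
  have int: "0 \<le> (LINT t:{0..T}|lborel. (norm (v t))\<^sup>2)"
    unfolding set_lebesgue_integral_def by (rule integral_nonneg_AE) simp
  have osc: "norm (x s - x 0) \<le> V" if s: "s \<in> {0..T}" for s
  proof -
    have "norm (x s - x 0) \<le> sqrt (\<bar>s - 0\<bar> * (LINT t:{0..T}|lborel. (norm (v t))\<^sup>2))"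
      by (rule weak_deriv_Hoelder_sqrt[OF v]) (use s T in auto)
    also have "\<dots> \<le> V"
      unfolding V_def real_sqrt_mult[symmetric] using s int by (intro real_sqrt_le_mono mult_right_mono) auto
    finally show ?thesis .
  qed
  have pos: "norm (\<omega> - 1) > 0" using c(3) by simp
  have "norm (x 0 $ i) \<le> V / norm (\<omega> - 1)" for i
  proof -
    have "(\<omega> - 1) * x 0 $ i = (x (2 * \<kappa>) - x 0) $ i"
      using loops_twisted[OF x, of "2 * \<kappa>" i] by (simp add: algebra_simps)
    then have "norm (\<omega> - 1) * norm (x 0 $ i) \<le> norm (x (2 * \<kappa>) - x 0)"
      using Finite_Cartesian_Product.norm_nth_le[of "x (2 * \<kappa>) - x 0" i] by (metis norm_mult)
    also have "\<dots> \<le> V" using \<kappa> by (intro osc) auto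
    finally show ?thesis using pos by (simp add: pos_le_divide_eq mult.commute)
  qed
  then have "norm (x 0) \<le> (\<Sum>i\<in>(UNIV :: 4 set). V / norm (\<omega> - 1))"
    unfolding norm_vec_def by (intro order_trans[OF L2_set_le_sum] sum_mono) auto
  also have "\<dots> = 4 / norm (\<omega> - 1) * V" by simp
  finally have "norm (x 0) \<le> 4 / norm (\<omega> - 1) * V" .
  moreover have "norm (x t) \<le> norm (x 0) + norm (x t - x 0)"
    using norm_triangle_ineq[of "x 0" "x t - x 0"] by simp
  ultimately have "norm (x t) \<le> 4 / norm (\<omega> - 1) * V + V" using osc[OF t] by linarith
  then show ?thesis by (simp add: V_def algebra_simps)
qed

lemma zero_in_loops: "(\<lambda>_. 0) \<in> loops"
proof -
  have "has_weak_deriv T (\<lambda>_. 0) (\<lambda>_. 0)" by (rule has_weak_deriv_C1) auto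
  then show ?thesis by (auto simp: loops_def loop_space_def config_space_def)
qed

lemma minimizer_exists: "\<exists>x. is_min_action T loops x"
proof (rule action_minimizer_exists[OF T])
  show "loops \<subseteq> loop_space T" using loopsD(1) by blast
  show "loops \<noteq> {}" using zero_in_loops by blast
qed (fact loops_coercive, fact loops_closed)

text \<open>The force is integrated twice within the class of twisted functions. The second
  primitive \<open>Y\<close> has to be a member of \<open>loops\<close>, so that
  \<open>x + e *\<^sub>R (x - Y)\<close> is an admissible competitor; this is why each symmetry is
  carried from the force to \<open>w\<close> and then to \<open>y\<close>.\<close>

lemma minimizer_newton_solution:
  assumes min: "is_min_action T loops x" and free: "collision_free x"
  shows "newton_solution x"
proof -
  have x: "x \<in> loops" using min by (simp add: is_min_action_def)
  note per = loop_space_periodic[OF loopsD(1)[OF x]]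
  define F where "F t = newton_force (x t)" for t
  have F_cont: "continuous_on UNIV F"
    unfolding F_def by (intro continuous_newton_force loop_space_continuous[OF T loopsD(1)[OF x]] free)
  have lin: "linear (\<lambda>z. a * cnj z)" "linear (\<lambda>z. a * z)" "linear (\<lambda>z :: complex. - z)" for a
    by (auto intro!: linearI simp: algebra_simps)
  have F1: "F t $ i = c1 * cnj (F (- t) $ p1 i)" for t i
    unfolding F_def by (rule newton_force_equivariant[of _ "\<lambda>z. c1 * cnj z"])
      (auto simp: lin bij_perm norm_mult c loopsD(2)[OF x, of t])
  have F2: "F t $ i = c2 * cnj (F (\<kappa> - t) $ p2 i)" for t i
    unfolding F_def by (rule newton_force_equivariant[of _ "\<lambda>z. c2 * cnj z"])
      (auto simp: lin bij_perm norm_mult c loopsD(3)[OF x, of t])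
  have F3: "F t $ i = - F t $ p1 i" for t i
    unfolding F_def by (rule newton_force_equivariant[of _ "\<lambda>z. - z"])
      (auto simp: lin bij_perm intro: loopsD(4)[OF x])
  have F\<omega>: "F t $ i = \<omega> * F (t - 2 * \<kappa>) $ i" for t i
    unfolding F_def by (rule newton_force_equivariant[of _ "\<lambda>z. \<omega> * z" _ id, unfolded id_apply])
      (use norm_\<omega> bij_id in \<open>auto simp: lin norm_mult id_def intro: loops_twisted[OF x]\<close>)
  have "\<exists>w. (\<forall>t. (w has_vector_derivative F t $ i) (at t)) \<and> (\<forall>t. w (t + T) = w t) \<and>
      (\<forall>t. w t = \<omega> * w (t - 2 * \<kappa>))" for i
  proof -
    have cont: "continuous_on UNIV (\<lambda>t. F t $ i)" by (intro continuous_intros F_cont)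
    have F_per: "F (t + T) $ i = F t $ i" for t by (simp add: F_def per)
    show ?thesis
      by (rule twisted_primitive_exists[where f = "\<lambda>t. F t $ i", OF c(3) cont F_per F\<omega>]) blast
  qed
  then obtain w where w: "\<And>i t. (w i has_vector_derivative F t $ i) (at t)"
    "\<And>i t. w i (t + T) = w i t" "\<And>i t. w i t = \<omega> * w i (t - 2 * \<kappa>)" by metis
  have w_cont: "continuous_on UNIV (w i)" for i
    using w(1) by (meson continuous_at_imp_continuous_on has_vector_derivative_continuous)
  have "\<exists>y. (\<forall>t. (y has_vector_derivative w i t) (at t)) \<and> (\<forall>t. y (t + T) = y t) \<and>
      (\<forall>t. y t = \<omega> * y (t - 2 * \<kappa>))" for i
    by (rule twisted_primitive_exists[where f = "w i", OF c(3) w_cont w(2) w(3)]) blast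
  then obtain y where y: "\<And>i t. (y i has_vector_derivative w i t) (at t)"
    "\<And>i t. y i (t + T) = y i t" "\<And>i t. y i t = \<omega> * y i (t - 2 * \<kappa>)" by metis
  \<comment> \<open>Time reversal contributes a factor -1 to the derivative, hence the sign in the
    assumption. It also inverts the time shift, while conjugation inverts \<omega>, so the
    transformed function obeys the same twisted relation.\<close>
  have transfer: "g = (\<lambda>t. c * cnj (h (b - t)))"
    if "\<And>t. (g has_vector_derivative f t) (at t)" "\<And>t. g t = \<omega> * g (t - 2 * \<kappa>)"
      "\<And>t. (h has_vector_derivative f' t) (at t)" "\<And>t. h t = \<omega> * h (t - 2 * \<kappa>)"
      "\<And>t. f t = - c * cnj (f' (b - t))" for g h f f' c b
  proof (rule twisted_primitive_unique[OF c(3) that(1,2)])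
    show "((\<lambda>t. c * cnj (h (b - t))) has_vector_derivative f t) (at t)" for t
      using has_vector_derivative_mult_right[OF has_vector_derivative_cnj[OF
          has_vector_derivative_real_affine[of h f' "-1" b t, OF that(3)]], of c] that(5)[of t]
      by simp
    show "c * cnj (h (b - t)) = \<omega> * (c * cnj (h (b - (t - 2 * \<kappa>))))" for t
    proof -
      have "h (b - (t - 2 * \<kappa>)) = \<omega> * h (b - t)" using that(4)[of "b - (t - 2 * \<kappa>)"] by simp
      then have "\<omega> * (c * cnj (h (b - (t - 2 * \<kappa>)))) = (\<omega> * cnj \<omega>) * (c * cnj (h (b - t)))" by simp
      then show ?thesis unfolding \<omega>_cnj mult_1_left by (rule sym)
    qed
  qed
  \<comment> \<open>Velocities acquire the sign of one time reversal, and positions lose it again in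
    the second integration.\<close>
  have w1: "w i = (\<lambda>t. - c1 * cnj (w (p1 i) (0 - t)))" for i
    by (rule transfer[OF w(1,3) w(1,3)]) (use F1[of _ i] in simp)
  have w2: "w i = (\<lambda>t. - c2 * cnj (w (p2 i) (\<kappa> - t)))" for i
    by (rule transfer[OF w(1,3) w(1,3)]) (use F2[of _ i] in simp)
  have y1: "y i = (\<lambda>t. c1 * cnj (y (p1 i) (0 - t)))" for i
    by (rule transfer[OF y(1,3) y(1,3)]) (use w1[of i] in \<open>simp add: fun_eq_iff\<close>)
  have y2: "y i = (\<lambda>t. c2 * cnj (y (p2 i) (\<kappa> - t)))" for i
    by (rule transfer[OF y(1,3) y(1,3)]) (use w2[of i] in \<open>simp add: fun_eq_iff\<close>)
  have w3: "w i = (\<lambda>t. - w (p1 i) t)" for i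
  proof (rule twisted_primitive_unique[OF c(3) w(1,3)])
    show "((\<lambda>t. - w (p1 i) t) has_vector_derivative F t $ i) (at t)" for t
      using has_vector_derivative_minus[OF w(1)[of "p1 i" t]] F3[of t i] by simp
    show "- w (p1 i) t = \<omega> * - w (p1 i) (t - 2 * \<kappa>)" for t
      using w(3)[of "p1 i" t] by simp
  qed
  have y3: "y i = (\<lambda>t. - y (p1 i) t)" for i
  proof (rule twisted_primitive_unique[OF c(3) y(1,3)])
    show "((\<lambda>t. - y (p1 i) t) has_vector_derivative w i t) (at t)" for t
      using has_vector_derivative_minus[OF y(1)[of "p1 i" t]] fun_cong[OF w3[of i], of t] by simp
    show "- y (p1 i) t = \<omega> * - y (p1 i) (t - 2 * \<kappa>)" for t
      using y(3)[of "p1 i" t] by simp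
  qed
  define Y where "Y t = (\<chi> i. y i t)" for t
  define W where "W t = (\<chi> i. w i t)" for t
  have Y': "(Y has_vector_derivative W t) (at t)" and W': "(W has_vector_derivative F t) (at t)" for t
    by (rule has_vector_derivative_vec_lambda; simp add: Y_def W_def y(1) w(1))+
  have W_cont: "continuous_on UNIV W"
    using W' by (meson continuous_at_imp_continuous_on has_vector_derivative_continuous)
  have Y_loops: "Y \<in> loops"
    unfolding loops_def loop_space_def
  proof (intro CollectI conjI allI)
    show "Y (t + T) = Y t" for t by (simp add: Y_def y(2))
    have "y 1 t = - y 2 t" "y 3 t = - y 4 t" for t
      using fun_cong[OF y3[of 1], of t] fun_cong[OF y3[of 3], of t] perms by auto
    then show "Y t \<in> config_space" for t by (simp add: config_space_def Y_def sum_4)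
    show "\<exists>v. has_weak_deriv T Y v" using has_weak_deriv_C1[OF Y' W_cont] by blast
    show "Y t $ i = c1 * cnj (Y (- t) $ p1 i)" for t i
      using fun_cong[OF y1[of i], of t] by (simp add: Y_def)
    show "Y t $ i = c2 * cnj (Y (\<kappa> - t) $ p2 i)" for t i
      using fun_cong[OF y2[of i], of t] by (simp add: Y_def)
    show "Y t $ i = - Y t $ p1 i" for t i
      using fun_cong[OF y3[of i], of t] by (simp add: Y_def)
  qed
  have "\<exists>d. \<forall>t. x t = Y t + d"
  proof (rule minimizer_eq_second_primitive[OF T loopsD(1)[OF x] free loopsD(1)[OF Y_loops] Y'])
    show "(W has_vector_derivative newton_force (x t)) (at t)" for t using W' by (simp add: F_def)
    show "W T = W 0" using w(2)[of _ 0] by (simp add: W_def)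
    fix e
    have "(\<lambda>t. x t + (- 1) *\<^sub>R Y t) \<in> loops" by (rule loops_add_scaleR[OF x Y_loops])
    then have "(\<lambda>t. x t + e *\<^sub>R (x t - Y t)) \<in> loops"
      using loops_add_scaleR[OF x, of "\<lambda>t. x t - Y t" e] by simp
    then show "action T x \<le> action T (\<lambda>t. x t + e *\<^sub>R (x t - Y t))"
      using min by (simp add: is_min_action_def)
  qed
  then obtain d where d: "x = (\<lambda>t. Y t + d)" by auto
  have "(x has_vector_derivative W t) (at t)" for t
    unfolding d using has_vector_derivative_add[OF Y' has_vector_derivative_const] by simp
  then show ?thesis
    using newton_solutionI[of x W] W' by (simp add: F_def)
qed

lemma not_homographic:
  assumes x: "x \<in> loops" and free: "collision_free x"
  shows "\<not> homographic x"
proof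
  assume "homographic x"
  then obtain s where s: "\<And>t i. x t $ i = s t * x 0 $ i" by (auto simp: homographic_def)
  define a where "a = x 0 $ 1"
  define b where "b = x 0 $ 3"
  have opp: "x 0 $ 2 = - a" "x 0 $ 4 = - b"
    using loopsD(4)[OF x, of 0 2] loopsD(4)[OF x, of 0 4] by (simp_all add: perms a_def b_def)
  \<comment> \<open>Time 0 is fixed by \<open>h1\<close>, which exchanges 1 and 2, and likewise 3
    and 4, while opposite bodies differ by a sign. So \<open>a\<close> and \<open>b\<close> both lie
    on the line fixed by \<open>z \<mapsto> - c1 * cnj z\<close>, the perpendicular to the first
    mirror.\<close>
  have ab: "a = - c1 * cnj a" "b = - c1 * cnj b"
    using loopsD(2)[OF x, of 0 1] loopsD(2)[OF x, of 0 3] opp by (simp_all add: perms a_def b_def)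
  have b0: "b \<noteq> 0"
    using free[unfolded collision_free_def, rule_format, of 3 4 0] opp distinct_4 by (auto simp: b_def)
  have "a / b = cnj (a / b)"
  proof -
    have "a * cnj b = (- c1 * cnj a) * cnj b" using ab(1) by simp
    also have "\<dots> = cnj a * b" using ab(2) by (metis mult.assoc mult.commute)
    finally show ?thesis using b0 by (simp add: field_simps)
  qed
  then have real: "a / b \<in> \<real>" by (metis Reals_cnj_iff)
  \<comment> \<open>If the scaling vanished at this time, all bodies would sit at the
    origin.\<close>
  have s0: "s (\<kappa> / 2) \<noteq> 0"
    using free[unfolded collision_free_def, rule_format, of 1 2 "\<kappa> / 2"] distinct_4
      s[of "\<kappa> / 2" 1] s[of "\<kappa> / 2" 2] by auto
  \<comment> \<open>The time \<open>\<kappa> / 2\<close> is fixed by \<open>h2\<close>, which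
    exchanges bodies 1 and 3 by a reflection. A homographic motion preserves ratios of lengths, so
    the equality carries back to time 0.\<close>
  have "norm (x (\<kappa> / 2) $ 1) = norm (x (\<kappa> / 2) $ 3)"
    using loopsD(3)[OF x, of "\<kappa> / 2" 1] c by (simp add: perms norm_mult)
  then have "norm a = norm b"
    using s0 unfolding s[of "\<kappa> / 2" 1] s[of "\<kappa> / 2" 3] by (simp add: norm_mult a_def b_def)
  then have "norm (a / b) = 1" using b0 by (simp add: norm_divide)
  then have "a / b = 1 \<or> a / b = - 1"
    using real by (auto elim!: Reals_cases simp: abs_if split: if_splits)
  then have "a = b \<or> a = - b" using b0 by (auto simp: divide_eq_eq)
  then show False
    using free[unfolded collision_free_def, rule_format, of 1 3 0]
      free[unfolded collision_free_def, rule_format, of 1 4 0] opp distinct_4 by (auto simp: a_def b_def)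
qed

end

theorem mainTheorem8:
  fixes T :: real and q L :: nat and l1 l2 :: complex
    and \<tau> :: "(int \<times> bool) \<times> int \<Rightarrow> real \<Rightarrow> real"
    and \<rho> :: "(int \<times> bool) \<times> int \<Rightarrow> complex \<Rightarrow> complex"
    and \<sigma> :: "(int \<times> bool) \<times> int \<Rightarrow> 4 \<Rightarrow> 4"
  assumes T: "T > 0" and q: "q > 2" and L: "L = lcm 2 q"
    and lines: "l1 \<noteq> 0" "l2 \<noteq> 0" "line_angle l1 l2 = pi / real q"
    and time_action: "group_action (sym_grp L) {0..<T} \<tau>"
      "\<forall>t\<in>{0..<T}. \<tau> h1 t = (- t) rmod T"
      "\<forall>t\<in>{0..<T}. \<tau> h2 t = (T / real L - t) rmod T"
      "\<forall>t\<in>{0..<T}. \<tau> h3 t = t"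
    and plane_action: "group_action (sym_grp L) UNIV \<rho>"
      "\<forall>g\<in>carrier (sym_grp L). orthogonal_transformation (\<rho> g)"
      "\<rho> h1 = line_reflection l1"
      "\<rho> h2 = line_reflection l2"
      "\<rho> h3 = (\<lambda>z. cis pi * z)"
    and index_action: "group_action (sym_grp L) UNIV \<sigma>"
      "\<sigma> h1 = Transposition.transpose 1 2 \<circ> Transposition.transpose 3 4"
      "\<sigma> h2 = Transposition.transpose 1 3 \<circ> Transposition.transpose 2 4"
      "\<sigma> h3 = Transposition.transpose 1 2 \<circ> Transposition.transpose 3 4"
    and local_minima: "\<forall>x. is_local_min_action T (fixed_loops (sym_grp L) T \<tau> \<rho> \<sigma>) x
      \<longrightarrow> collision_free x"
  shows "(\<exists>x. is_min_action T (fixed_loops (sym_grp L) T \<tau> \<rho> \<sigma>) x) \<and>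
    (\<forall>x. is_min_action T (fixed_loops (sym_grp L) T \<tau> \<rho> \<sigma>) x \<longrightarrow>
      collision_free x \<and> (\<forall>t. x (t + T) = x t) \<and> newton_solution x \<and> \<not> homographic x)"
proof -
  have "even L" "L > 0" using L q by (auto simp: lcm_pos_nat)
  then have L2: "L \<ge> 2" by (auto elim!: evenE)
  define c1 where "c1 = l1 / cnj l1"
  define c2 where "c2 = l2 / cnj l2"
  have \<rho>: "\<rho> h1 = (\<lambda>z. c1 * cnj z)" "\<rho> h2 = (\<lambda>z. c2 * cnj z)" "\<rho> h3 = uminus"
    using plane_action(3-5) line_reflection_eq lines(1,2) by (auto simp: c1_def c2_def fun_eq_iff)
  interpret symmetric_loops T "T / real L" c1 c2 "\<sigma> h1" "\<sigma> h2"
  proof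
    show "2 * (T / real L) \<le> T" using T L2 by (simp add: pos_divide_le_eq)
    show "(c2 * cnj c1)\<^sup>2 \<noteq> 1"
      unfolding c1_def c2_def by (rule line_reflections_rotation_neq_1[OF lines q])
  qed (use T L2 lines index_action in \<open>auto simp: c1_def c2_def norm_divide\<close>)
  have \<sigma>: "\<sigma> h1 \<circ> \<sigma> h1 = id" "\<sigma> h2 \<circ> \<sigma> h2 = id" "\<sigma> h3 = \<sigma> h1"
    using perm_inv index_action(2,4) by (auto simp: fun_eq_iff)
  have L1: "L > 1" using L2 by simp
  \<comment> \<open>The time maps are brought into the common affine form that
    \<open>loop_act_involution_fixed_iff\<close> expects.\<close>
  have \<tau>: "\<forall>t\<in>{0..<T}. \<tau> h1 t = (- 1 * t + 0) rmod T"
    "\<forall>t\<in>{0..<T}. \<tau> h2 t = (- 1 * t + T / real L) rmod T"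
    "\<forall>t\<in>{0..<T}. \<tau> h3 t = (1 * t + 0) rmod T"
    using time_action(2-4) T by auto
  have fixed: "fixed_loops (sym_grp L) T \<tau> \<rho> \<sigma> = loops"
  proof -
    have "(\<forall>g\<in>{h1, h2, h3}. loop_act (sym_grp L) T \<tau> \<rho> \<sigma> g x = x) \<longleftrightarrow>
        (\<forall>t i. x t $ i = c1 * cnj (x (- t) $ \<sigma> h1 i) \<and>
          x t $ i = c2 * cnj (x (T / real L - t) $ \<sigma> h2 i) \<and> x t $ i = - x t $ \<sigma> h1 i)"
      if x: "x \<in> loop_space T" for x
    proof -
      note fixed_iff = loop_act_involution_fixed_iff[where G = "sym_grp L" and x = x
          and \<tau> = \<tau> and \<rho> = \<rho> and \<sigma> = \<sigma>, OF T loop_space_periodic[OF x]]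
      have "loop_act (sym_grp L) T \<tau> \<rho> \<sigma> h1 x = x \<longleftrightarrow> (\<forall>t i. x t $ i = c1 * cnj (x (- t) $ \<sigma> h1 i))"
        using fixed_iff[where a = "- 1" and b = 0, OF inv_generators_sym_grp(1)[OF L1] \<tau>(1) _ \<sigma>(1)] by (simp add: \<rho>)
      moreover have "loop_act (sym_grp L) T \<tau> \<rho> \<sigma> h2 x = x \<longleftrightarrow>
          (\<forall>t i. x t $ i = c2 * cnj (x (T / real L - t) $ \<sigma> h2 i))"
        using fixed_iff[where a = "- 1" and b = "T / real L", OF inv_generators_sym_grp(2)[OF L1] \<tau>(2) _ \<sigma>(2)] by (simp add: \<rho>)
      moreover have "loop_act (sym_grp L) T \<tau> \<rho> \<sigma> h3 x = x \<longleftrightarrow> (\<forall>t i. x t $ i = - x t $ \<sigma> h1 i)"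
        using fixed_iff[where a = 1 and b = 0, OF inv_generators_sym_grp(3)[OF L1] \<tau>(3)] \<sigma> by (simp add: \<rho>)
      ultimately show ?thesis by blast
    qed
    then show ?thesis
      unfolding fixed_loops_sym_grp[OF T L1 time_action(1) plane_action(1) index_action(1)] loops_def
      by blast
  qed
  \<comment> \<open>A global minimizer is a local one for every radius, so the assumption on local
    minima applies to it.\<close>
  have "collision_free x" if "is_min_action T loops x" for x
  proof -
    have "is_local_min_action T loops x"
      using that zero_less_one unfolding is_min_action_def is_local_min_action_def by blast
    then show ?thesis using local_minima unfolding fixed by blast
  qed
  moreover have "x \<in> loops" if "is_min_action T loops x" for x
    using that by (simp add: is_min_action_def)
  ultimately show ?thesis
    unfolding fixed using minimizer_exists minimizer_newton_solution not_homographic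
      loop_space_periodic[OF loopsD(1)] by blast
qed

end
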